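(* Every simple torsion free $\mathfrak{sl}(2)$-module has finite rank, so the set of isomorphism classes of simple torsion free $\mathfrak{sl}(2)$-modules equals the set of isomorphism classes of simple torsion free finite rank $\mathfrak{sl}(2)$-modules. The rationalization functor $F_{\mathrm{rat}}$ induces a bijection from this set onto the set of isomorphism classes of $\mathcal{RC}$-simple objects of $\mathcal{RC}$, and the latter set equals the set of isomorphism classes of $\mathcal R$-simple objects of $\mathcal R$ (in particular every $\mathcal R$-simple rational module is a Casimir module).
   Context: $\mathfrak{sl}(2)$ has basis $L_{-1}=f$, $L_0=-\tfrac12 h$, $L_1=-e$ for a Chevalley basis $e,f,h$. Every $\mathfrak{sl}(2)$-module $(V,\rho)$ is a $\mathbb{C}[z]$-module via $z\cdot v=\rho(L_0)v$; it is torsion free if it is torsion free as a $\mathbb{C}[z]$-module, and of finite rank if $S^{-1}V$ is a finite-dimensional $\mathbb{C}(z)$-vector space, where $S=\mathbb{C}[z]\setminus\{0\}$. Casimir operator: $C_\rho=\rho(L_0)(\rho(L_0)-1)-\rho(L_{-1})\rho(L_1)$; $V$ is Casimir if $C_\rho=\mu\,\mathrm{Id}$ for some $\mu\in\mathbb{C}$. A rational module is an $\mathfrak{sl}(2)$-module which, with its $\mathbb{C}[z]$-structure, is a finite-dimensional $\mathbb{C}(z)$-vector space; $\mathcal R$ is the full subcategory of rational modules and $\mathcal{RC}$ the full subcategory of rational Casimir modules. An object of $\mathcal R$ (resp. $\mathcal{RC}$) is $\mathcal R$-simple (resp. $\mathcal{RC}$-simple) if it is nonzero and has no nonzero proper subobject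 in $\mathcal R$ (resp. $\mathcal{RC}$), i.e. no nonzero proper $\mathfrak{sl}(2)$-submodule that is a $\mathbb{C}(z)$-subspace (and Casimir). The rationalization functor sends a torsion free finite rank $(V,\rho)$ to $F_{\mathrm{rat}}(V,\rho)=(S^{-1}V,\rho_{\mathrm{rat}})$ with $\rho_{\mathrm{rat}}(L_{-1})(v/p(z))=\rho(L_{-1})(v)/p(z-1)$, $\rho_{\mathrm{rat}}(L_0)(v/p(z))=z v/p(z)$, $\rho_{\mathrm{rat}}(L_1)(v/p(z))=\rho(L_1)(v)/p(z+1)$. *)

theory Defs
  imports "HOL-Computational_Algebra.Polynomial" "HOL-Computational_Algebra.Fraction_Field"
          "HOL-Algebra.Module"
begin

definition CC :: "complex ring" where
  "CC = \<lparr>carrier = UNIV, monoid.mult = (*), one = 1, zero = 0, add = (+)\<rparr>"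

definition CZ :: "complex poly fract ring" where
  "CZ = \<lparr>carrier = UNIV, monoid.mult = (*), one = 1, zero = 0, add = (+)\<rparr>"

text \<open>An sl(2)-module: a complex vector space (HOL-Algebra module over CC) together with the
  actions of the basis elements L_{-1} (Lm), L_0 (L0), L_1 (Lp).\<close>

record 'b sl2mod = "(complex, 'b) module" +
  Lm :: "'b \<Rightarrow> 'b"
  L0 :: "'b \<Rightarrow> 'b"
  Lp :: "'b \<Rightarrow> 'b"

definition lin_endo :: "'b sl2mod \<Rightarrow> ('b \<Rightarrow> 'b) \<Rightarrow> bool" where
  "lin_endo V T \<longleftrightarrow> (\<forall>x\<in>carrier V. T x \<in> carrier V)
     \<and> (\<forall>x\<in>carrier V. \<forall>y\<in>carrier V. T (add V x y) = add V (T x) (T y))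
     \<and> (\<forall>c. \<forall>x\<in>carrier V. T (Module.smult V c x) = Module.smult V c (T x))"

definition comm_eq :: "'b sl2mod \<Rightarrow> ('b \<Rightarrow> 'b) \<Rightarrow> ('b \<Rightarrow> 'b) \<Rightarrow> complex \<Rightarrow> ('b \<Rightarrow> 'b) \<Rightarrow> bool" where
  "comm_eq V S T c U \<longleftrightarrow> (\<forall>x\<in>carrier V.
      add V (S (T x)) (Module.smult V (-1) (T (S x))) = Module.smult V c (U x))"

text \<open>Relations [L_m, L_n] = (m - n) L_{m+n} of the basis L_{-1}, L_0, L_1 of sl(2).\<close>
definition is_sl2mod :: "'b sl2mod \<Rightarrow> bool" where
  "is_sl2mod V \<longleftrightarrow> module CC V \<and> lin_endo V (Lm V) \<and> lin_endo V (L0 V) \<and> lin_endo V (Lp V)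
     \<and> comm_eq V (L0 V) (Lm V) 1 (Lm V)
     \<and> comm_eq V (Lp V) (L0 V) 1 (Lp V)
     \<and> comm_eq V (Lp V) (Lm V) 2 (L0 V)"

definition polyact :: "'b sl2mod \<Rightarrow> complex poly \<Rightarrow> 'b \<Rightarrow> 'b" where
  "polyact V p v = foldr (\<lambda>c acc. add V (Module.smult V c v) (L0 V acc)) (coeffs p) (zero V)"

definition torsion_free :: "'b sl2mod \<Rightarrow> bool" where
  "torsion_free V \<longleftrightarrow> (\<forall>p. p \<noteq> 0 \<longrightarrow> (\<forall>v\<in>carrier V. polyact V p v = zero V \<longrightarrow> v = zero V))"

text \<open>Action of C(z) when every nonzero p(rho(L_0)) is bijective: (p/q) v = p . q^{-1} v.\<close>
definition cz_smult :: "'b sl2mod \<Rightarrow> complex poly fract \<Rightarrow> 'b \<Rightarrow> 'b" where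
  "cz_smult V r v = (case (SOME (p, q). q \<noteq> 0 \<and> r = Fract p q) of (p, q) \<Rightarrow>
      polyact V p (the_inv_into (carrier V) (polyact V q) v))"

definition Cz_module :: "'b sl2mod \<Rightarrow> (complex poly fract, 'b) module" where
  "Cz_module V = \<lparr>carrier = carrier V, monoid.mult = monoid.mult V, one = one V,
      zero = zero V, add = add V, smult = cz_smult V\<rparr>"

definition Cz_fin_dim :: "'b sl2mod \<Rightarrow> bool" where
  "Cz_fin_dim V \<longleftrightarrow> (\<exists>bs. set bs \<subseteq> carrier V \<and> (\<forall>v\<in>carrier V. \<exists>cs. length cs = length bs \<and>
       v = foldr (add V) (map2 (cz_smult V) cs bs) (zero V)))"

definition rational :: "'b sl2mod \<Rightarrow> bool" where
  "rational V \<longleftrightarrow> is_sl2mod V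
     \<and> (\<forall>p. p \<noteq> 0 \<longrightarrow> bij_betw (polyact V p) (carrier V) (carrier V))
     \<and> module CZ (Cz_module V) \<and> Cz_fin_dim V"

definition casimir_op :: "'b sl2mod \<Rightarrow> 'b \<Rightarrow> 'b" where
  "casimir_op V v = add V (add V (L0 V (L0 V v)) (Module.smult V (-1) (L0 V v)))
                           (Module.smult V (-1) (Lm V (Lp V v)))"

definition casimir :: "'b sl2mod \<Rightarrow> bool" where
  "casimir V \<longleftrightarrow> (\<exists>\<mu>::complex. \<forall>v\<in>carrier V. casimir_op V v = Module.smult V \<mu> v)"

definition sl2_submod :: "'b sl2mod \<Rightarrow> 'b set \<Rightarrow> bool" where
  "sl2_submod V U \<longleftrightarrow> U \<subseteq> carrier V \<and> zero V \<in> U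
     \<and> (\<forall>x\<in>U. \<forall>y\<in>U. add V x y \<in> U) \<and> (\<forall>c. \<forall>x\<in>U. Module.smult V c x \<in> U)
     \<and> (\<forall>x\<in>U. Lm V x \<in> U \<and> L0 V x \<in> U \<and> Lp V x \<in> U)"

definition simple :: "'b sl2mod \<Rightarrow> bool" where
  "simple V \<longleftrightarrow> is_sl2mod V \<and> carrier V \<noteq> {zero V}
     \<and> (\<forall>U. sl2_submod V U \<longrightarrow> U = {zero V} \<or> U = carrier V)"

definition R_sub :: "'b sl2mod \<Rightarrow> 'b set \<Rightarrow> bool" where
  "R_sub V U \<longleftrightarrow> sl2_submod V U \<and> (\<forall>r. \<forall>x\<in>U. cz_smult V r x \<in> U)"

definition RC_sub :: "'b sl2mod \<Rightarrow> 'b set \<Rightarrow> bool" where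
  "RC_sub V U \<longleftrightarrow> R_sub V U \<and> casimir (V\<lparr>carrier := U\<rparr>)"

definition R_simple :: "'b sl2mod \<Rightarrow> bool" where
  "R_simple V \<longleftrightarrow> rational V \<and> carrier V \<noteq> {zero V}
     \<and> (\<forall>U. R_sub V U \<longrightarrow> U = {zero V} \<or> U = carrier V)"

definition RC_simple :: "'b sl2mod \<Rightarrow> bool" where
  "RC_simple V \<longleftrightarrow> rational V \<and> casimir V \<and> carrier V \<noteq> {zero V}
     \<and> (\<forall>U. RC_sub V U \<longrightarrow> U = {zero V} \<or> U = carrier V)"

definition sl2_iso :: "'a sl2mod \<Rightarrow> 'b sl2mod \<Rightarrow> bool" where
  "sl2_iso V W \<longleftrightarrow> (\<exists>f. bij_betw f (carrier V) (carrier W)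
     \<and> (\<forall>x\<in>carrier V. \<forall>y\<in>carrier V. f (add V x y) = add W (f x) (f y))
     \<and> (\<forall>c. \<forall>x\<in>carrier V. f (Module.smult V c x) = Module.smult W c (f x))
     \<and> (\<forall>x\<in>carrier V. f (Lm V x) = Lm W (f x) \<and> f (L0 V x) = L0 W (f x)
                       \<and> f (Lp V x) = Lp W (f x)))"

definition locrel :: "'b sl2mod \<Rightarrow> (('b \<times> complex poly) \<times> ('b \<times> complex poly)) set" where
  "locrel V = {((v, p), (w, q)). v \<in> carrier V \<and> w \<in> carrier V \<and> p \<noteq> 0 \<and> q \<noteq> 0
                 \<and> polyact V q v = polyact V p w}"

definition frac_cls :: "'b sl2mod \<Rightarrow> 'b \<Rightarrow> complex poly \<Rightarrow> ('b \<times> complex poly) set" where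
  "frac_cls V v p = locrel V `` {(v, p)}"

definition frac_rep :: "('b \<times> complex poly) set \<Rightarrow> 'b \<times> complex poly" where
  "frac_rep X = (SOME x. x \<in> X)"

definition Frat :: "'b sl2mod \<Rightarrow> ('b \<times> complex poly) set sl2mod" where
  "Frat V = \<lparr>carrier = (carrier V \<times> {p. p \<noteq> 0}) // locrel V,
     monoid.mult = (\<lambda>_ _. undefined), one = undefined,
     zero = frac_cls V (zero V) 1,
     add = (\<lambda>X Y. case frac_rep X of (v, p) \<Rightarrow> case frac_rep Y of (w, q) \<Rightarrow>
              frac_cls V (add V (polyact V q v) (polyact V p w)) (p * q)),
     smult = (\<lambda>c X. case frac_rep X of (v, p) \<Rightarrow> frac_cls V (Module.smult V c v) p),
     Lm = (\<lambda>X. case frac_rep X of (v, p) \<Rightarrow> frac_cls V (Lm V v) (pcompose p [:-1, 1:])),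
     L0 = (\<lambda>X. case frac_rep X of (v, p) \<Rightarrow> frac_cls V (L0 V v) p),
     Lp = (\<lambda>X. case frac_rep X of (v, p) \<Rightarrow> frac_cls V (Lp V v) (pcompose p [:1, 1:]))\<rparr>"

definition finite_rank :: "'b sl2mod \<Rightarrow> bool" where
  "finite_rank V \<longleftrightarrow> Cz_fin_dim (Frat V)"

end

theory Submission
  imports Defs "HOL-Computational_Algebra.Fundamental_Theorem_Algebra"
    "HOL-Computational_Algebra.Polynomial_Factorial" "HOL-Computational_Algebra.Field_as_Ring"
    "HOL-Analysis.Continuum_Not_Denumerable"
begin

text \<open>By Dixmier's lemma the Casimir operator of a simple module \<open>V\<close> is a scalar \<open>\<mu>\<close>, so that
  \<open>L\<^sub>-\<^sub>1 L\<^sub>1 = z(z - 1) - \<mu>\<close>. If \<open>V\<close> is torsion free, \<open>v\<close> lies in the submodule generated by \<open>z v\<close>, which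
  yields a relation \<open>r\<^sub>0 v + r\<^sub>1 L\<^sub>-\<^sub>1 v + \<dots> + r\<^sub>d L\<^sub>-\<^sub>1\<^sup>d v = 0\<close> with \<open>r\<^sub>0, r\<^sub>d \<noteq> 0\<close>, and \<open>V\<close> has rank at most \<open>d\<close>.
  A rational submodule of \<open>F\<^sub>r\<^sub>a\<^sub>t V\<close> is determined by its intersection with \<open>V\<close>, so \<open>F\<^sub>r\<^sub>a\<^sub>t V\<close> is simple,
  and \<open>V\<close> is recovered as its unique simple submodule.

  Conversely let \<open>M\<close> be a simple rational module and \<open>v \<in> M\<close> nonzero. A nonzero submodule \<open>N\<close> contains
  \<open>s v\<close> for some polynomial \<open>s \<noteq> 0\<close>. Such a relation, which exists because \<open>M\<close> is finite-dimensional
  and \<open>L\<^sub>-\<^sub>1\<close> is injective, shows that the roots of an optimal \<open>s\<close> lie in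
  \<open>roots(r\<^sub>0) + \<nat>\<close>, and the analogous relation for \<open>L\<^sub>1\<close> that they lie in \<open>roots(t\<^sub>0) - \<nat>\<close>. The
  intersection of these sets is finite, so one polynomial \<open>g\<close> with \<open>g v \<in> N\<close> serves all \<open>N\<close>. Hence the
  intersection of all nonzero submodules is nonzero; it is a simple module with rationalization \<open>M\<close>,
  and its Casimir scalar is that of \<open>M\<close>.\<close>

subsection \<open>Modules over integral domains and linear relations\<close>

text \<open>Gaussian elimination without division: a pivot row clears the last column by cross
  multiplication, so the solution stays in the domain.\<close>

lemma idom_dependent:
  fixes c :: "'j \<Rightarrow> nat \<Rightarrow> 'k::idom"
  assumes "finite J" "card J > n"
  shows "\<exists>b. (\<exists>j\<in>J. b j \<noteq> 0) \<and> (\<forall>i<n. (\<Sum>j\<in>J. b j * c j i) = 0)"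
  using assms
proof (induction n arbitrary: J c)
  case 0
  then have "J \<noteq> {}" by auto
  then show ?case by (intro exI[of _ "\<lambda>_. 1"]) auto
next
  case (Suc n)
  show ?case
  proof (cases "\<forall>j\<in>J. c j n = 0")
    case True
    from Suc.IH[of J c] Suc.prems obtain b where b: "\<exists>j\<in>J. b j \<noteq> 0"
      "\<forall>i<n. (\<Sum>j\<in>J. b j * c j i) = 0" by auto
    have "\<forall>i<Suc n. (\<Sum>j\<in>J. b j * c j i) = 0"
      using b(2) True by (auto simp: less_Suc_eq)
    with b(1) show ?thesis by blast
  next
    case False
    then obtain k where k: "k \<in> J" "c k n \<noteq> 0" by auto
    define d where "d j i = c k n * c j i - c j n * c k i" for j i
    have fin: "finite (J - {k})" and "card (J - {k}) > n" using Suc.prems k by auto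
    from Suc.IH[OF this, of d] obtain b where b: "\<exists>j\<in>J-{k}. b j \<noteq> 0"
      "\<forall>i<n. (\<Sum>j\<in>J-{k}. b j * d j i) = 0" by auto
    have b2: "(\<Sum>j\<in>J-{k}. b j * d j i) = 0" if "i < Suc n" for i
      using b(2) that by (cases "i = n") (auto simp: d_def)
    \<comment> \<open>The other coefficients are multiplied by the pivot \<open>c k n\<close>, so
      that the equation for column n determines the coefficient of row k without a division.\<close>
    define b' where "b' j = (if j = k then - (\<Sum>j\<in>J-{k}. b j * c j n) else b j * c k n)" for j
    have "(\<Sum>j\<in>J. b' j * c j i) = 0" if "i < Suc n" for i
    proof -
      have "(\<Sum>j\<in>J. b' j * c j i) = b' k * c k i + (\<Sum>j\<in>J-{k}. b' j * c j i)"
        using Suc.prems(1) k(1) by (rule sum.remove)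
      also have "(\<Sum>j\<in>J-{k}. b' j * c j i) = (\<Sum>j\<in>J-{k}. b j * c k n * c j i)"
        by (rule sum.cong) (auto simp: b'_def)
      also have "b' k * c k i + \<dots> = (\<Sum>j\<in>J-{k}. b j * d j i)"
        by (simp add: b'_def d_def sum_distrib_left sum_distrib_right sum_subtractf algebra_simps)
      finally show ?thesis using b2[OF that] by simp
    qed
    moreover have "\<exists>j\<in>J. b' j \<noteq> 0" using b(1) k by (auto simp: b'_def)
    ultimately show ?thesis by blast
  qed
qed

text \<open>One vector space carries actions of \<complex>, \<complex>[z] and \<complex>(z); an
  arbitrary integral domain of scalars treats them together.\<close>

locale kmod = abelian_group V for V (structure) +
  fixes act :: "'k::idom \<Rightarrow> 'a \<Rightarrow> 'a"
  assumes act_closed [simp, intro]: "x \<in> carrier V \<Longrightarrow> act c x \<in> carrier V"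
    and act_add_left: "x \<in> carrier V \<Longrightarrow> act (c + d) x = act c x \<oplus> act d x"
    and act_add_right: "x \<in> carrier V \<Longrightarrow> y \<in> carrier V \<Longrightarrow> act c (x \<oplus> y) = act c x \<oplus> act c y"
    and act_mult: "x \<in> carrier V \<Longrightarrow> act (c * d) x = act c (act d x)"
    and act_one [simp]: "x \<in> carrier V \<Longrightarrow> act 1 x = x"
begin

lemma act_zero_left [simp]: "x \<in> carrier V \<Longrightarrow> act 0 x = \<zero>"
  using act_add_left[of x 0 0] by simp

lemma act_zero_right [simp]: "act c \<zero> = \<zero>"
  using act_add_right[of \<zero> \<zero> c] by simp

lemma act_minus: "x \<in> carrier V \<Longrightarrow> act (- c) x = \<ominus> act c x"
  using act_add_left[of x "-c" c] by (simp add: minus_equality)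

lemma act_uminus_right: "x \<in> carrier V \<Longrightarrow> act c (\<ominus> x) = \<ominus> act c x"
  using act_add_right[of "\<ominus> x" x c] by (simp add: minus_equality l_neg)

lemma act_diff_left: "x \<in> carrier V \<Longrightarrow> act (c - d) x = act c x \<ominus> act d x"
  using act_add_left[of x c "-d"] by (simp add: act_minus a_minus_def)

lemma act_commute: "x \<in> carrier V \<Longrightarrow> act c (act d x) = act d (act c x)"
  by (metis act_mult mult.commute)

text \<open>The same shape as the expression in \<open>Cz_fin_dim\<close>, which then unfolds to a
  statement about \<open>lincomb\<close>.\<close>

definition lincomb :: "'k list \<Rightarrow> 'a list \<Rightarrow> 'a" where
  "lincomb cs bs = foldr (add V) (map2 act cs bs) \<zero>"

lemma lincomb_Nil [simp]: "lincomb [] bs = \<zero>" "lincomb cs [] = \<zero>"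
  by (simp_all add: lincomb_def)

lemma lincomb_Cons [simp]: "lincomb (c # cs) (b # bs) = act c b \<oplus> lincomb cs bs"
  by (simp add: lincomb_def)

lemma lincomb_closed [simp, intro]: "set bs \<subseteq> carrier V \<Longrightarrow> lincomb cs bs \<in> carrier V"
proof (induction bs arbitrary: cs)
  case (Cons b bs) then show ?case by (cases cs) auto
qed simp

lemma lincomb_append:
  "length cs = length bs \<Longrightarrow> set bs \<subseteq> carrier V \<Longrightarrow> set bs' \<subseteq> carrier V \<Longrightarrow>
   lincomb (cs @ cs') (bs @ bs') = lincomb cs bs \<oplus> lincomb cs' bs'"
  by (induction cs bs rule: list_induct2) (auto simp: a_assoc)

lemma act_lincomb: "length cs = length bs \<Longrightarrow> set bs \<subseteq> carrier V \<Longrightarrow>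
   act c (lincomb cs bs) = lincomb (map ((*) c) cs) bs"
  by (induction cs bs rule: list_induct2) (auto simp: act_add_right act_mult)

lemma lincomb_map:
  assumes "\<And>x. x \<in> carrier V \<Longrightarrow> T x \<in> carrier V"
    and "\<And>x y. x \<in> carrier V \<Longrightarrow> y \<in> carrier V \<Longrightarrow> T (x \<oplus> y) = T x \<oplus> T y"
    and "\<And>c x. x \<in> carrier V \<Longrightarrow> T (act c x) = act c (T x)"
    and "length cs = length bs" "set bs \<subseteq> carrier V"
  shows "T (lincomb cs bs) = lincomb cs (map T bs)"
proof -
  have "T \<zero> = \<zero>" using assms(3)[of \<zero> 0] assms(1)[of \<zero>] by simp
  with assms(4,5) show ?thesis
    by (induction cs bs rule: list_induct2) (auto simp: assms(1-3))
qed

lemma lincomb_fun_add: "set bs \<subseteq> carrier V \<Longrightarrow>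
   lincomb (map (\<lambda>i. f i + g i) is) bs = lincomb (map f is) bs \<oplus> lincomb (map g is) bs"
proof (induction bs arbitrary: "is")
  case (Cons b bs)
  then show ?case by (cases "is") (auto simp: act_add_left a_ac)
qed simp

lemma lincomb_fun_zero: "set bs \<subseteq> carrier V \<Longrightarrow> (\<And>i. i \<in> set is \<Longrightarrow> f i = 0) \<Longrightarrow>
   lincomb (map f is) bs = \<zero>"
proof (induction bs arbitrary: "is")
  case (Cons b bs)
  then show ?case by (cases "is") auto
qed simp

text \<open>More vectors than generators satisfy a linear relation. To avoid finite sums in \<open>V\<close>, the
  combinations are formed in an abelian group mapping to \<open>V\<close> by \<open>\<Phi>\<close>.\<close>

lemma exists_relation:
  fixes \<Phi> :: "'g::comm_monoid_add \<Rightarrow> 'a" and act' :: "'k \<Rightarrow> 'j \<Rightarrow> 'g"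
  assumes P0: "\<Phi> 0 = \<zero>" and Padd: "\<And>g h. \<Phi> (g + h) = \<Phi> g \<oplus> \<Phi> h"
    and fin: "finite J" "card J > length bs" and bs: "set bs \<subseteq> carrier V"
    and rep: "\<And>j. j \<in> J \<Longrightarrow> \<exists>cs. length cs = length bs \<and> (\<forall>b. \<Phi> (act' b j) = act b (lincomb cs bs))"
  shows "\<exists>b. (\<exists>j\<in>J. b j \<noteq> 0) \<and> \<Phi> (\<Sum>j\<in>J. act' (b j) j) = \<zero>"
proof -
  define rep' where "rep' j = (SOME cs. length cs = length bs \<and> (\<forall>b. \<Phi> (act' b j) = act b (lincomb cs bs)))" for j
  have rep': "length (rep' j) = length bs" "\<Phi> (act' b j) = act b (lincomb (rep' j) bs)" if "j \<in> J" for j b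
    using someI_ex[OF rep[OF that]] unfolding rep'_def[symmetric] by auto
  from idom_dependent[OF fin, of "\<lambda>j i. rep' j ! i"] obtain b where b: "\<exists>j\<in>J. b j \<noteq> 0"
    "\<forall>i<length bs. (\<Sum>j\<in>J. b j * rep' j ! i) = 0"
    using fin by metis
  have eq: "\<Phi> (\<Sum>j\<in>K. act' (b j) j) = lincomb (map (\<lambda>i. \<Sum>j\<in>K. b j * rep' j ! i) [0..<length bs]) bs"
    if "K \<subseteq> J" for K
    using finite_subset[OF that fin(1)] that
  proof (induction K rule: finite_induct)
    case empty then show ?case by (simp add: P0 lincomb_fun_zero bs)
  next
    case (insert j K)
    have "map ((*) (b j)) (rep' j) = map (\<lambda>i. b j * rep' j ! i) [0..<length bs]"
      using rep'(1)[of j] insert.prems by (intro nth_equalityI) auto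
    then have "\<Phi> (act' (b j) j) = lincomb (map (\<lambda>i. b j * rep' j ! i) [0..<length bs]) bs"
      using rep'[of j] insert.prems act_lincomb[of "rep' j" bs "b j"] bs by auto
    with insert show ?case by (simp add: Padd lincomb_fun_add bs)
  qed
  have "\<Phi> (\<Sum>j\<in>J. act' (b j) j) = \<zero>"
    using eq[of J] b(2) lincomb_fun_zero[OF bs, of "[0..<length bs]" "\<lambda>i. \<Sum>j\<in>J. b j * rep' j ! i"] by simp
  with b(1) show ?thesis by blast
qed

end

subsection \<open>The action of the polynomial ring\<close>

text \<open>The instances of interest are \<open>CC\<close> and \<open>CZ\<close>.\<close>

lemma univ_cring:
  "cring \<lparr>carrier = UNIV :: 'k set, monoid.mult = (*), one = (1::'k::idom), zero = 0, add = (+)\<rparr>"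
proof (rule cringI)
  show "abelian_group \<lparr>carrier = UNIV :: 'k set, monoid.mult = (*), one = (1::'k::idom), zero = 0, add = (+)\<rparr>"
  proof (rule abelian_groupI)
    fix x :: 'k
    show "\<exists>y\<in>carrier \<lparr>carrier = UNIV :: 'k set, monoid.mult = (*), one = (1::'k::idom), zero = 0, add = (+)\<rparr>.
      y \<oplus>\<^bsub>\<lparr>carrier = UNIV, monoid.mult = (*), one = (1::'k::idom), zero = 0, add = (+)\<rparr>\<^esub> x =
      \<zero>\<^bsub>\<lparr>carrier = UNIV, monoid.mult = (*), one = (1::'k::idom), zero = 0, add = (+)\<rparr>\<^esub>"
      by (auto intro: exI[of _ "-x"])
  qed (auto simp: algebra_simps)
qed (auto intro!: comm_monoidI simp: algebra_simps)

lemma kmod_of_module_CC: "module CC V \<Longrightarrow> kmod V (Module.smult V)"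
  unfolding module_def module_axioms_def kmod_def kmod_axioms_def by (auto simp: CC_def)

lemma module_CC_of_kmod: "kmod V (Module.smult V) \<Longrightarrow> module CC V"
  unfolding module_def module_axioms_def kmod_def kmod_axioms_def using univ_cring[where 'k = complex]
  by (auto simp: CC_def)

text \<open>A vector space with one operator: Dixmier's argument uses the polynomial calculus with
  the Casimir operator in place of \<open>L0\<close>.\<close>

locale zmod =
  fixes V :: "'a sl2mod" (structure)
  assumes module_V: "module CC V" and lin_L0: "lin_endo V (L0 V)"

sublocale zmod \<subseteq> C: kmod V "Module.smult V"
  by (rule kmod_of_module_CC[OF module_V])

context zmod
begin

lemma minus_eq_smult: "x \<in> carrier V \<Longrightarrow> \<ominus> x = -1 \<odot> x"
  using C.act_minus[of x 1] by simp

lemma eq_diff_iff: "x \<in> carrier V \<Longrightarrow> y \<in> carrier V \<Longrightarrow> z \<in> carrier V \<Longrightarrow> x \<ominus> y = z \<longleftrightarrow> x = z \<oplus> y"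
proof -
  assume *: "x \<in> carrier V" "y \<in> carrier V" "z \<in> carrier V"
  then have "x \<ominus> y \<oplus> y = x" by (simp add: C.minus_eq C.a_assoc C.l_neg)
  moreover have "z \<oplus> y \<ominus> y = z" using * by (simp add: C.minus_eq C.a_assoc C.r_neg)
  ultimately show "x \<ominus> y = z \<longleftrightarrow> x = z \<oplus> y" by auto
qed

lemma r_neg3: "x \<in> carrier V \<Longrightarrow> y \<in> carrier V \<Longrightarrow> x \<oplus> (y \<oplus> \<ominus> x) = y"
  and l_neg3: "x \<in> carrier V \<Longrightarrow> y \<in> carrier V \<Longrightarrow> \<ominus> x \<oplus> (y \<oplus> x) = y"
  by (simp_all add: C.a_comm[of y] C.r_neg1 C.r_neg2)

lemmas ab_simps = C.minus_eq C.minus_add C.minus_minus C.r_neg C.r_neg1 C.r_neg2 r_neg3 l_neg3 C.a_ac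

abbreviation pa (infixr "\<cdot>" 75) where "p \<cdot> x \<equiv> polyact V p x"

lemma lin_endoD:
  assumes "lin_endo V T"
  shows "x \<in> carrier V \<Longrightarrow> T x \<in> carrier V"
    and "x \<in> carrier V \<Longrightarrow> y \<in> carrier V \<Longrightarrow> T (x \<oplus> y) = T x \<oplus> T y"
    and "x \<in> carrier V \<Longrightarrow> T (c \<odot> x) = c \<odot> T x"
    and "T \<zero> = \<zero>"
    and "x \<in> carrier V \<Longrightarrow> T (\<ominus> x) = \<ominus> T x"
    and "x \<in> carrier V \<Longrightarrow> y \<in> carrier V \<Longrightarrow> T (x \<ominus> y) = T x \<ominus> T y"
proof -
  have closed: "T x \<in> carrier V" and smult: "T (c \<odot> x) = c \<odot> T x" if "x \<in> carrier V" for x c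
    using assms that unfolding lin_endo_def by auto
  have add: "T (x \<oplus> y) = T x \<oplus> T y" if "x \<in> carrier V" "y \<in> carrier V" for x y
    using assms that unfolding lin_endo_def by auto
  show "x \<in> carrier V \<Longrightarrow> T x \<in> carrier V" "x \<in> carrier V \<Longrightarrow> T (c \<odot> x) = c \<odot> T x"
    "x \<in> carrier V \<Longrightarrow> y \<in> carrier V \<Longrightarrow> T (x \<oplus> y) = T x \<oplus> T y"
    by (fact closed smult add)+
  show "T \<zero> = \<zero>" using smult[of \<zero> 0] closed[of \<zero>] by simp
  have 4: "T (\<ominus> x) = \<ominus> T x" if "x \<in> carrier V" for x
    using that by (simp add: minus_eq_smult closed smult)
  then show "x \<in> carrier V \<Longrightarrow> T (\<ominus> x) = \<ominus> T x" .
  show "x \<in> carrier V \<Longrightarrow> y \<in> carrier V \<Longrightarrow> T (x \<ominus> y) = T x \<ominus> T y"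
    by (simp add: C.minus_eq add 4)
qed

lemmas L0_simps [simp] = lin_endoD[OF lin_L0]

lemma polyact_0 [simp]: "0 \<cdot> x = \<zero>"
  by (simp add: polyact_def)

lemma polyact_pCons: "x \<in> carrier V \<Longrightarrow> pCons c p \<cdot> x = c \<odot> x \<oplus> L0 V (p \<cdot> x)"
  by (cases "p = 0 \<and> c = 0") (auto simp: polyact_def cCons_def)

lemma polyact_closed: "x \<in> carrier V \<Longrightarrow> p \<cdot> x \<in> carrier V"
  by (induction p) (auto simp: polyact_pCons)

lemma polyact_linear:
  assumes T: "lin_endo V T" and comm: "\<And>x. x \<in> carrier V \<Longrightarrow> T (L0 V x) = L0 V (T x)"
  shows "x \<in> carrier V \<Longrightarrow> T (p \<cdot> x) = p \<cdot> T x"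
  by (induction p) (auto simp: polyact_pCons lin_endoD[OF T] polyact_closed comm)

lemma polyact_add: "x \<in> carrier V \<Longrightarrow> (p + q) \<cdot> x = p \<cdot> x \<oplus> q \<cdot> x"
  by (induction p q rule: poly_induct2) (auto simp: polyact_pCons polyact_closed C.act_add_left C.a_ac)

lemma polyact_smult: "x \<in> carrier V \<Longrightarrow> Polynomial.smult c p \<cdot> x = c \<odot> p \<cdot> x"
  by (induction p) (auto simp: polyact_pCons polyact_closed C.act_add_right C.act_mult)

lemma polyact_mult: "x \<in> carrier V \<Longrightarrow> (p * q) \<cdot> x = p \<cdot> q \<cdot> x"
  by (induction p) (auto simp: polyact_pCons polyact_closed polyact_add polyact_smult)

lemma lin_polyact: "lin_endo V (polyact V p)"
proof -
  have "p \<cdot> (x \<oplus> y) = p \<cdot> x \<oplus> p \<cdot> y" if "x \<in> carrier V" "y \<in> carrier V" for x y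
    using that by (induction p) (auto simp: polyact_pCons polyact_closed C.act_add_right C.a_ac)
  moreover have "p \<cdot> (c \<odot> x) = c \<odot> p \<cdot> x" if "x \<in> carrier V" for x c
    using that by (induction p) (auto simp: polyact_pCons polyact_closed C.act_add_right
      C.act_commute)
  ultimately show ?thesis by (auto simp: lin_endo_def polyact_closed)
qed

end

sublocale zmod \<subseteq> P: kmod V "polyact V"
proof (intro kmod.intro kmod_axioms.intro)
  show "1 \<cdot> x = x" if "x \<in> carrier V" for x
    using that by (simp add: one_pCons polyact_pCons)
qed (fact C.abelian_group_axioms polyact_closed polyact_add polyact_mult lin_endoD(2)[OF lin_polyact])+

section \<open>Operators semilinear over \<complex>[z]\<close>

context zmod
begin

lemma polyact_const [simp]: "x \<in> carrier V \<Longrightarrow> [:c:] \<cdot> x = c \<odot> x"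
  by (simp add: polyact_pCons)

lemma polyact_X [simp]: "x \<in> carrier V \<Longrightarrow> [:0, 1:] \<cdot> x = L0 V x"
  by (simp add: polyact_pCons)

lemma polyact_smult_commute: "x \<in> carrier V \<Longrightarrow> p \<cdot> (c \<odot> x) = c \<odot> p \<cdot> x"
  using lin_endoD(3)[OF lin_polyact] .

text \<open>T z = (z + a) T: \<open>Lm\<close> is the case a = -1 and \<open>Lp\<close> the case a =
  1, and one argument covers both.\<close>

definition semilin :: "complex \<Rightarrow> ('a \<Rightarrow> 'a) \<Rightarrow> bool" where
  "semilin a T \<longleftrightarrow> lin_endo V T \<and> (\<forall>x\<in>carrier V. T (L0 V x) = [:a, 1:] \<cdot> T x)"

lemma semilin_lin: "semilin a T \<Longrightarrow> lin_endo V T" by (simp add: semilin_def)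

lemmas semilinD = lin_endoD[OF semilin_lin]

lemma semilin_polyact:
  assumes T: "semilin a T" and x: "x \<in> carrier V"
  shows "T (p \<cdot> x) = (p \<circ>\<^sub>p [:a, 1:]) \<cdot> T x"
proof (induction p)
  case (pCons c p)
  note [simp] = semilinD[OF T]
  have "T (L0 V (p \<cdot> x)) = [:a, 1:] \<cdot> T (p \<cdot> x)"
    using T x by (auto simp: semilin_def)
  also have "\<dots> = ([:a, 1:] * (p \<circ>\<^sub>p [:a, 1:])) \<cdot> T x"
    using pCons.IH x by (metis polyact_mult semilinD(1)[OF T])
  finally have "T (pCons c p \<cdot> x) = [:c:] \<cdot> T x \<oplus> ([:a, 1:] * (p \<circ>\<^sub>p [:a, 1:])) \<cdot> T x"
    using T x by (simp add: polyact_pCons)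
  then show ?case
    using x by (simp only: pcompose_pCons polyact_add semilinD(1)[OF T])
qed (use semilinD(4)[OF T] x in auto)

end

lemma pcompose_shift_shift: "(p \<circ>\<^sub>p [:a, 1:]) \<circ>\<^sub>p [:b, 1:] = p \<circ>\<^sub>p [:a + b, 1:]" for p :: "'k::idom poly"
  by (simp add: pcompose_assoc[symmetric] pcompose_pCons add.commute)

lemma pcompose_shift_0 [simp]: "p \<circ>\<^sub>p [:0, 1:] = p" for p :: "'k::idom poly"
  by (simp add: pcompose_idR)

lemma pcompose_shift_eq_0_iff [simp]: "p \<circ>\<^sub>p [:a, 1:] = 0 \<longleftrightarrow> p = 0" for p :: "'k::idom poly"
  by (simp add: pcompose_eq_0_iff)

section \<open>The sl(2) relations and the Casimir operator\<close>

locale sl2 =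
  fixes V :: "'a sl2mod" (structure)
  assumes is_sl2: "is_sl2mod V"

sublocale sl2 \<subseteq> zmod
  using is_sl2 by (auto simp: is_sl2mod_def intro: zmod.intro)

context sl2
begin

lemma lin_Lm: "lin_endo V (Lm V)" and lin_Lp: "lin_endo V (Lp V)"
  using is_sl2 by (auto simp: is_sl2mod_def)

lemma sl2_relations:
  assumes "x \<in> carrier V"
  shows "L0 V (Lm V x) = Lm V x \<oplus> Lm V (L0 V x)" "Lp V (L0 V x) = Lp V x \<oplus> L0 V (Lp V x)"
    "Lp V (Lm V x) = 2 \<odot> L0 V x \<oplus> Lm V (Lp V x)"
  using is_sl2 assms lin_endoD(1)[OF lin_Lm] lin_endoD(1)[OF lin_Lp]
  by (auto simp: is_sl2mod_def comm_eq_def minus_eq_smult[symmetric] C.minus_eq[symmetric] eq_diff_iff)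

lemma semilin_Lm: "semilin (-1) (Lm V)"
proof -
  have "Lm V (L0 V x) = [:-1, 1:] \<cdot> Lm V x" if x: "x \<in> carrier V" for x
  proof -
    have "[:-1, 1:] \<cdot> Lm V x = \<ominus> Lm V x \<oplus> L0 V (Lm V x)"
      using x by (simp add: polyact_pCons lin_endoD[OF lin_Lm] minus_eq_smult)
    also have "\<dots> = Lm V (L0 V x)"
      using x by (simp add: sl2_relations lin_endoD[OF lin_Lm] C.r_neg1)
    finally show ?thesis by simp
  qed
  then show ?thesis by (simp add: semilin_def lin_Lm)
qed

lemma semilin_Lp: "semilin 1 (Lp V)"
proof -
  have "Lp V (L0 V x) = [:1, 1:] \<cdot> Lp V x" if x: "x \<in> carrier V" for x
    using x by (simp add: polyact_pCons lin_endoD[OF lin_Lp] sl2_relations)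
  then show ?thesis by (simp add: semilin_def lin_Lp)
qed

lemmas Lm_simps [simp] = lin_endoD[OF lin_Lm]
lemmas Lp_simps [simp] = lin_endoD[OF lin_Lp]

abbreviation cas where "cas \<equiv> casimir_op V"

lemma cas_eq: "x \<in> carrier V \<Longrightarrow> cas x = [:0, -1, 1:] \<cdot> x \<ominus> Lm V (Lp V x)"
  by (simp add: casimir_op_def polyact_pCons minus_eq_smult[symmetric] C.minus_eq C.a_comm)

lemma lin_cas: "lin_endo V cas"
proof -
  have "cas (c \<odot> x) = c \<odot> cas x" if "x \<in> carrier V" for c x
    using that by (simp add: casimir_op_def C.act_add_right C.act_commute)
  then show ?thesis
    by (simp add: lin_endo_def cas_eq C.minus_eq P.act_add_right C.minus_add C.a_ac)
qed

lemmas cas_simps [simp] = lin_endoD[OF lin_cas]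

lemma Lm_Lp: "x \<in> carrier V \<Longrightarrow> Lm V (Lp V x) = [:0, -1, 1:] \<cdot> x \<ominus> cas x"
  by (simp add: cas_eq ab_simps)

text \<open>The commutator [L_1, L_-1] = 2 L_0 adds 2 z to the z^2 - z of
  \<open>Lm_Lp\<close>.\<close>

lemma Lp_Lm: "x \<in> carrier V \<Longrightarrow> Lp V (Lm V x) = [:0, 1, 1:] \<cdot> x \<ominus> cas x"
proof -
  assume x: "x \<in> carrier V"
  have "[:0, 1, 1:] \<cdot> x = ([:0, 2:] + [:0, -1, 1:]) \<cdot> x" by simp
  also have "\<dots> = 2 \<odot> L0 V x \<oplus> [:0, -1, 1:] \<cdot> x"
    using x by (subst P.act_add_left) (simp_all add: polyact_pCons[of x 0] )
  finally show ?thesis using x by (simp add: sl2_relations(3) Lm_Lp C.minus_eq C.a_assoc)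
qed

text \<open>\<open>Lp\<close> and \<open>Lm\<close> shift z in opposite directions, so their
  composite commutes with \<open>L0\<close>.\<close>

lemma cas_L0: "x \<in> carrier V \<Longrightarrow> cas (L0 V x) = L0 V (cas x)"
proof -
  assume x: "x \<in> carrier V"
  have "Lm V (Lp V (L0 V x)) = [:-1, 1:] \<cdot> Lm V (Lp V x) \<oplus> Lm V (Lp V x)"
    using x by (simp add: sl2_relations(2) semilin_Lm[unfolded semilin_def] C.a_comm)
  also have "\<dots> = L0 V (Lm V (Lp V x))"
    using x by (simp add: polyact_pCons minus_eq_smult[symmetric] ab_simps)
  finally show ?thesis
    using x polyact_linear[OF lin_L0, of x "[:0,-1,1:]"] by (simp add: cas_eq)
qed

lemma cas_polyact: "x \<in> carrier V \<Longrightarrow> cas (p \<cdot> x) = p \<cdot> cas x"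
  using polyact_linear[of cas, OF lin_cas cas_L0] .

text \<open>The shift z -> z - 1 carried by \<open>Lm\<close> turns the z^2 + z of
  \<open>Lp_Lm\<close> into the z^2 - z of \<open>cas_eq\<close>; \<open>cas_Lp\<close> uses the
  opposite shift.\<close>

lemma cas_Lm: "x \<in> carrier V \<Longrightarrow> cas (Lm V x) = Lm V (cas x)"
proof -
  assume x: "x \<in> carrier V"
  have "Lm V (cas x) = Lm V ([:0, 1, 1:] \<cdot> x \<ominus> Lp V (Lm V x))"
    using x by (simp add: Lp_Lm ab_simps)
  also have "\<dots> = [:0, -1, 1:] \<cdot> Lm V x \<ominus> Lm V (Lp V (Lm V x))"
    using x by (simp add: semilin_polyact[OF semilin_Lm] pcompose_pCons)
  finally show ?thesis using x by (simp add: cas_eq)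
qed

lemma cas_Lp: "x \<in> carrier V \<Longrightarrow> cas (Lp V x) = Lp V (cas x)"
proof -
  assume x: "x \<in> carrier V"
  have "Lp V (cas x) = [:0, 1, 1:] \<cdot> Lp V x \<ominus> Lp V (Lm V (Lp V x))"
    using x by (simp add: cas_eq semilin_polyact[OF semilin_Lp] pcompose_pCons)
  also have "\<dots> = cas (Lp V x)"
    using x by (simp add: Lp_Lm ab_simps)
  finally show ?thesis by (rule sym)
qed

end

subsection \<open>Dixmier's lemma\<close>

context zmod
begin

text \<open>Complex polynomials split into linear factors, which can be removed from a relation p x
  = 0 one at a time.\<close>

lemma torsion_freeI:
  assumes inj: "\<And>a x. x \<in> carrier V \<Longrightarrow> [:-a, 1:] \<cdot> x = \<zero> \<Longrightarrow> x = \<zero>"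
  shows "torsion_free V"
proof -
  have "x = \<zero>" if "p \<noteq> 0" "x \<in> carrier V" "p \<cdot> x = \<zero>" for p x
    using that
  proof (induction "degree p" arbitrary: p)
    case 0
    then obtain c where c: "p = [:c:]" "c \<noteq> 0" by (metis degree_eq_zeroE pCons_0_0)
    have "inverse c \<odot> (c \<odot> x) = \<zero>" using 0 c by simp
    then show ?case using c 0 by (simp add: C.act_mult[symmetric])
  next
    case (Suc n)
    then have "\<not> constant (poly p)" by (simp add: constant_degree)
    then obtain a where "poly p a = 0" using fundamental_theorem_of_algebra by blast
    then obtain q where q: "p = [:-a, 1:] * q" by (metis poly_eq_0_iff_dvd dvdE)
    have "q \<noteq> 0" using Suc q by auto
    then have "degree q = n" using Suc.hyps(2) unfolding q by (subst (asm) degree_mult_eq) auto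
    moreover have "q \<cdot> x = \<zero>"
      using inj[of "q \<cdot> x" a] Suc.prems unfolding q by (simp only: polyact_mult P.act_closed)
    ultimately show ?case using Suc \<open>q \<noteq> 0\<close> by blast
  qed
  then show ?thesis by (auto simp: torsion_free_def)
qed

text \<open>The operator r_0 + r_1 T + ... + r_d T^d applied to x. The type
  \<open>complex poly poly\<close> stores the coefficients r_i; its product is not the composition
  of operators.\<close>

definition pact :: "('a \<Rightarrow> 'a) \<Rightarrow> complex poly poly \<Rightarrow> 'a \<Rightarrow> 'a" where
  "pact T R x = foldr (\<lambda>r f y. r \<cdot> y \<oplus> f (T y)) (coeffs R) (\<lambda>_. \<zero>) x"

lemma pact_0 [simp]: "pact T 0 x = \<zero>"
  by (simp add: pact_def)

context
  fixes T :: "'a \<Rightarrow> 'a" and a :: complex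
  assumes T: "semilin a T"
begin

lemmas T_simps [simp] = semilinD[OF T]

lemma pact_pCons: "x \<in> carrier V \<Longrightarrow> pact T (pCons r R) x = r \<cdot> x \<oplus> pact T R (T x)"
  by (cases "R = 0 \<and> r = 0") (auto simp: pact_def cCons_def)

lemma pact_closed [simp]: "x \<in> carrier V \<Longrightarrow> pact T R x \<in> carrier V"
  by (induction R arbitrary: x) (auto simp: pact_pCons)

lemma pact_add: "x \<in> carrier V \<Longrightarrow> pact T (R + S) x = pact T R x \<oplus> pact T S x"
  by (induction R S arbitrary: x rule: poly_induct2) (auto simp: pact_pCons P.act_add_left C.a_ac)

lemma pact_smult: "x \<in> carrier V \<Longrightarrow> pact T (Polynomial.smult p R) x = p \<cdot> pact T R x"
  by (induction R arbitrary: x) (auto simp: pact_pCons P.act_add_right P.act_mult)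

lemma pact_diff: "x \<in> carrier V \<Longrightarrow> pact T (R - S) x = pact T R x \<ominus> pact T S x"
  using pact_add[of x R "-S"] pact_smult[of x "-1" S] by (simp add: P.act_minus C.minus_eq)

lemma pow_closed [simp]: "x \<in> carrier V \<Longrightarrow> (T ^^ n) x \<in> carrier V"
  by (induction n) auto

lemma pow_polyact: "x \<in> carrier V \<Longrightarrow> (T ^^ n) (p \<cdot> x) = (p \<circ>\<^sub>p [:of_nat n * a, 1:]) \<cdot> (T ^^ n) x"
  by (induction n) (auto simp: semilin_polyact[OF T] pcompose_shift_shift algebra_simps)

lemma pact_monom: "x \<in> carrier V \<Longrightarrow> pact T (monom r n) x = r \<cdot> (T ^^ n) x"
  by (induction n arbitrary: x) (auto simp: monom_0 monom_Suc pact_pCons funpow_swap1)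

text \<open>Moving \<open>T\<close> from the left of the coefficients to their right shifts each of
  them by a.\<close>

lemma pact_semilin: "x \<in> carrier V \<Longrightarrow>
  T (pact T R x) = pact T (map_poly (\<lambda>r. r \<circ>\<^sub>p [:a, 1:]) R) (T x)"
  by (induction R arbitrary: x) (auto simp: pact_pCons semilin_polyact[OF T] map_poly_pCons)

end

end

section \<open>Submodules and generators\<close>

context sl2
begin

lemma submodD:
  assumes "sl2_submod V N"
  shows "x \<in> N \<Longrightarrow> x \<in> carrier V" "\<zero> \<in> N" "x \<in> N \<Longrightarrow> y \<in> N \<Longrightarrow> x \<oplus> y \<in> N"
    "x \<in> N \<Longrightarrow> c \<odot> x \<in> N" "x \<in> N \<Longrightarrow> Lm V x \<in> N" "x \<in> N \<Longrightarrow> L0 V x \<in> N" "x \<in> N \<Longrightarrow> Lp V x \<in> N"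
  using assms unfolding sl2_submod_def by auto

lemma submod_polyact: "sl2_submod V N \<Longrightarrow> x \<in> N \<Longrightarrow> p \<cdot> x \<in> N"
  by (induction p) (auto simp: polyact_pCons submodD)

lemma submod_minus: "sl2_submod V N \<Longrightarrow> x \<in> N \<Longrightarrow> \<ominus> x \<in> N"
  using submodD(4)[of N x "-1"] submodD(1)[of N x] by (simp add: minus_eq_smult)

text \<open>For Schur's argument: on a simple module these two submodules are zero or
  everything.\<close>

lemma submod_kernel_image:
  assumes T: "lin_endo V T"
    and c: "\<And>x. x \<in> carrier V \<Longrightarrow> T (Lm V x) = Lm V (T x)"
      "\<And>x. x \<in> carrier V \<Longrightarrow> T (L0 V x) = L0 V (T x)"
      "\<And>x. x \<in> carrier V \<Longrightarrow> T (Lp V x) = Lp V (T x)"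
  shows "sl2_submod V {x \<in> carrier V. T x = \<zero>}" "sl2_submod V (T ` carrier V)"
proof -
  note [simp] = lin_endoD[OF T]
  show "sl2_submod V {x \<in> carrier V. T x = \<zero>}"
    by (auto simp: sl2_submod_def c)
  show "sl2_submod V (T ` carrier V)"
    unfolding sl2_submod_def
  proof (intro conjI allI ballI)
    show "\<zero> \<in> T ` carrier V" by (rule image_eqI[of _ _ \<zero>]) auto
  next
    fix x y assume "x \<in> T ` carrier V" "y \<in> T ` carrier V"
    then obtain x' y' where "x' \<in> carrier V" "y' \<in> carrier V" "x = T x'" "y = T y'" by auto
    then show "x \<oplus> y \<in> T ` carrier V" by (intro image_eqI[of _ _ "x' \<oplus> y'"]) auto
  next
    fix k x assume "x \<in> T ` carrier V"
    then obtain x' where "x' \<in> carrier V" "x = T x'" by auto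
    then show "k \<odot> x \<in> T ` carrier V" by (intro image_eqI[of _ _ "k \<odot> x'"]) auto
  qed (auto simp flip: c)
qed

end

lemma abelian_group_update:
  "abelian_group (V\<lparr>L0 := T\<rparr>) \<longleftrightarrow> abelian_group (V :: 'a sl2mod)"
  by (simp add: abelian_group_def abelian_monoid_def abelian_group_axioms_def)

lemma uncountable_complex: "uncountable (UNIV :: complex set)"
proof
  assume "countable (UNIV :: complex set)"
  then have "countable (range complex_of_real)" by (rule countable_subset[rotated]) auto
  then have "countable (UNIV :: real set)"
    by (rule countable_image_inj_on) (auto intro: injI)
  then show False using uncountable_UNIV_real by blast
qed

text \<open>The words in the three operators, applied to v, are countably many, and their span is a
  nonzero submodule.\<close>

lemma (in sl2) countable_generators:
  assumes S: "simple V" and v: "v \<in> carrier V" "v \<noteq> \<zero>"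
  obtains W where "countable W" "W \<subseteq> carrier V"
    "\<And>x. x \<in> carrier V \<Longrightarrow> \<exists>cs bs. set bs \<subseteq> W \<and> length cs = length bs \<and> x = C.lincomb cs bs"
proof -
  \<comment> \<open>Words are lists of natural numbers, every index from 2 on standing for
    \<open>Lp\<close>; such lists are countable.\<close>
  define ops where "ops i = (if i = 0 then Lm V else if i = 1 then L0 V else Lp V)" for i :: nat
  define W where "W = range (\<lambda>l. foldr ops l v)"
  have ops_lin: "lin_endo V (ops i)" for i by (simp add: ops_def lin_Lm lin_L0 lin_Lp)
  have "foldr ops l v \<in> carrier V" for l
    by (induction l) (auto simp: v lin_endoD[OF ops_lin])
  then have WV: "W \<subseteq> carrier V" by (auto simp: W_def)
  have opsW: "ops i x \<in> W" if "x \<in> W" for i x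
  proof -
    from that obtain l where "x = foldr ops l v" by (auto simp: W_def)
    then have "ops i x = foldr ops (i # l) v" by simp
    then show ?thesis unfolding W_def by blast
  qed
  define S where "S = {x. \<exists>cs bs. set bs \<subseteq> W \<and> length cs = length bs \<and> x = C.lincomb cs bs}"
  have ops_S: "ops i x \<in> S" if "x \<in> S" for i x
  proof -
    from that obtain cs bs where *: "set bs \<subseteq> W" "length cs = length bs" "x = C.lincomb cs bs"
      by (auto simp: S_def)
    have "ops i x = C.lincomb cs (map (ops i) bs)"
      unfolding *(3) using * WV by (intro C.lincomb_map) (auto simp: lin_endoD[OF ops_lin])
    then show ?thesis using * opsW unfolding S_def
      by (intro CollectI exI[of _ cs] exI[of _ "map (ops i) bs"]) auto
  qed
  have "sl2_submod V S"
    unfolding sl2_submod_def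
  proof (intro conjI allI ballI subsetI)
    show "x \<in> carrier V" if "x \<in> S" for x using that WV by (auto simp: S_def)
    show "\<zero> \<in> S" unfolding S_def by (intro CollectI exI[of _ "[]"]) auto
    fix x assume x: "x \<in> S"
    from x obtain cs bs where *: "set bs \<subseteq> W" "length cs = length bs" "x = C.lincomb cs bs"
      by (auto simp: S_def)
    show "c \<odot> x \<in> S" for c unfolding S_def
      by (intro CollectI exI[of _ "map ((*) c) cs"] exI[of _ bs])
        (use * WV C.act_lincomb in auto)
    show "Lm V x \<in> S" "L0 V x \<in> S" "Lp V x \<in> S"
      using ops_S[OF x, of 0] ops_S[OF x, of 1] ops_S[OF x, of 2] by (auto simp: ops_def)
    fix y assume "y \<in> S"
    then obtain cs' bs' where **: "set bs' \<subseteq> W" "length cs' = length bs'" "y = C.lincomb cs' bs'"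
      by (auto simp: S_def)
    show "x \<oplus> y \<in> S" unfolding S_def
      by (intro CollectI exI[of _ "cs @ cs'"] exI[of _ "bs @ bs'"])
        (use * ** WV in \<open>auto simp: C.lincomb_append\<close>)
  qed
  moreover have "v \<in> S"
  proof -
    have "v \<in> W" unfolding W_def by (rule range_eqI[of _ _ "[]"]) simp
    then show ?thesis unfolding S_def
      by (intro CollectI exI[of _ "[1]"] exI[of _ "[v]"]) (use v in auto)
  qed
  ultimately have "S = carrier V" using S v unfolding simple_def by blast
  moreover have "countable W" unfolding W_def by auto
  ultimately show ?thesis using that[of W] WV unfolding S_def by blast
qed

text \<open>Dixmier's argument: if no \<open>C - a\<close> were singular, the vectors \<open>(C - a)\<^sup>-\<^sup>1 v\<close> would be
  uncountably many linearly independent vectors of a space of countable dimension.\<close>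

theorem (in sl2) simple_casimir:
  assumes S: "simple V"
  shows "casimir V"
proof (rule ccontr)
  assume "\<not> casimir V"
  then have nc: "\<exists>x\<in>carrier V. cas x \<noteq> a \<odot> x" for a by (auto simp: casimir_def)
  \<comment> \<open>Here \<open>polyact W p\<close> is p(C) for the Casimir operator C.\<close>
  define W where "W = V\<lparr>L0 := cas\<rparr>"
  have [simp]: "carrier W = carrier V" "add W = add V" "zero W = zero V"
    "Module.smult W = Module.smult V" "L0 W = cas"
    by (auto simp: W_def)
  have agW: "abelian_group W"
    using C.abelian_group_axioms by (simp add: W_def abelian_group_update)
  then have "kmod W (Module.smult W)"
    using C.kmod_axioms by (auto simp: kmod_def kmod_axioms_def)
  then interpret W: zmod W
    by (intro zmod.intro module_CC_of_kmod) (use lin_cas in \<open>auto simp: lin_endo_def\<close>)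
  define T where "T a x = cas x \<ominus> a \<odot> x" for a x
  have T: "polyact W [:-a, 1:] x = T a x" if "x \<in> carrier V" for a x
    using that by (simp add: W.polyact_pCons T_def C.act_minus C.minus_eq C.a_comm)
  have T0: "T a x = \<zero> \<longleftrightarrow> cas x = a \<odot> x" if "x \<in> carrier V" for a x
    using that eq_diff_iff[of "cas x" "a \<odot> x" \<zero>] by (simp add: T_def)
  have linT: "lin_endo V (T a)" for a
    by (auto simp: T_def lin_endo_def ab_simps C.act_add_right C.act_commute C.act_uminus_right)
  have submod: "sl2_submod V {x \<in> carrier V. T a x = \<zero>}" "sl2_submod V (T a ` carrier V)" for a
    by (intro submod_kernel_image[OF linT]; auto simp: T_def cas_Lm cas_L0 cas_Lp)+
  \<comment> \<open>C - a is not zero, because C is assumed not to be scalar; by simplicity it is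
    bijective.\<close>
  have "{x \<in> carrier V. T a x = \<zero>} = {\<zero>}" for a
    using submod(1)[of a] S nc[of a] T0 unfolding simple_def by blast
  then have inj: "x = \<zero>" if "x \<in> carrier V" "T a x = \<zero>" for a x using that by blast
  have "T a ` carrier V \<noteq> {\<zero>}" for a
    using nc[of a] T0 by auto
  then have surj: "T a ` carrier V = carrier V" for a
    using submod(2)[of a] S unfolding simple_def by blast
  obtain v where v: "v \<in> carrier V" "v \<noteq> \<zero>"
    using S C.zero_closed unfolding simple_def by blast
  have "\<exists>x. x \<in> carrier V \<and> T a x = v" for a using surj[of a] v by (metis imageE)
  then obtain X where X: "\<And>a. X a \<in> carrier V" "\<And>a. T a (X a) = v" by metis
  obtain G where G: "countable G" "G \<subseteq> carrier V"
    "\<And>x. x \<in> carrier V \<Longrightarrow> \<exists>cs bs. set bs \<subseteq> G \<and> length cs = length bs \<and> x = C.lincomb cs bs"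
    using countable_generators[OF S v] by blast
  have "\<exists>bs. bs \<in> lists G \<and> (\<exists>cs. length cs = length bs \<and> X a = C.lincomb cs bs)" for a
    using G(3)[OF X(1)[of a]] by (auto simp: in_lists_conv_set)
  then obtain F where F: "\<And>a. F a \<in> lists G"
    "\<And>a. \<exists>cs. length cs = length (F a) \<and> X a = C.lincomb cs (F a)" by metis
  \<comment> \<open>Pigeonhole: uncountably many \<open>X a\<close> are expressed through countably
    many finite lists of generators, so one list serves infinitely many a.\<close>
  have "\<exists>bs. infinite {a. F a = bs}"
  proof (rule ccontr)
    assume "\<nexists>bs. infinite {a. F a = bs}"
    then have "countable (\<Union>bs\<in>lists G. {a. F a = bs})"
      by (intro countable_UN countable_lists G(1)) (auto intro: countable_finite)
    moreover have "(\<Union>bs\<in>lists G. {a. F a = bs}) = UNIV" using F(1) by auto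
    ultimately show False using uncountable_complex by simp
  qed
  then obtain bs where "infinite {a. F a = bs}" ..
  then obtain J where J: "finite J" "card J = Suc (length bs)" "J \<subseteq> {a. F a = bs}"
    by (metis infinite_arbitrarily_large)
  have "J \<noteq> {}" using J by auto
  then have bs: "set bs \<subseteq> carrier V" using F(1) J(3) G(2) by fastforce
  \<comment> \<open>Since (C - j) \<open>X j\<close> = v, the product over \<open>J\<close> sends
    \<open>X j\<close> to the product of the C - l with l \<noteq> j, applied to v. A relation
    between these images becomes a polynomial in C that kills v.\<close>
  define L where "L K = (\<Prod>l\<in>K. [:-l, 1:])" for K :: "complex set"
  define D where "D = map (polyact W (L J)) bs"
  have "\<exists>b. (\<exists>j\<in>J. b j \<noteq> 0) \<and>
      polyact W (\<Sum>j\<in>J. Polynomial.smult (b j) (L (J - {j}))) v = \<zero>"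
  proof (rule C.exists_relation[where bs = D])
    show "polyact W 0 v = \<zero>" "\<And>g h. polyact W (g + h) v = polyact W g v \<oplus> polyact W h v"
      using v W.polyact_0 W.polyact_add by auto
    show "finite J" "card J > length D" "set D \<subseteq> carrier V"
      using J bs W.polyact_closed by (auto simp: D_def)
    fix j assume j: "j \<in> J"
    then obtain cs where cs: "length cs = length bs" "X j = C.lincomb cs bs" using F(2) J(3) by blast
    have "polyact W (Polynomial.smult b (L (J - {j}))) v = b \<odot> C.lincomb cs D" for b
    proof -
      have "polyact W (L (J - {j})) v = polyact W (L (J - {j}) * [:-j, 1:]) (X j)"
        by (subst W.polyact_mult) (simp_all add: X T del: mult_pCons_right)
      also have "L (J - {j}) * [:-j, 1:] = L J"
        using prod.remove[OF J(1) j, of "\<lambda>l. [:-l, 1:]"] by (simp add: L_def mult.commute)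
      also have "polyact W (L J) (X j) = C.lincomb cs D"
        unfolding cs(2) D_def using W.lin_endoD[OF W.lin_polyact] cs(1) bs
        by (intro C.lincomb_map) auto
      finally show ?thesis using v W.polyact_smult by simp
    qed
    then show "\<exists>cs. length cs = length D \<and>
        (\<forall>b. polyact W (Polynomial.smult b (L (J - {j}))) v = b \<odot> C.lincomb cs D)"
      using cs(1) by (auto simp: D_def)
  qed
  then obtain b k where b: "k \<in> J" "b k \<noteq> 0"
    "polyact W (\<Sum>j\<in>J. Polynomial.smult (b j) (L (J - {j}))) v = \<zero>" by blast
  \<comment> \<open>Every C - a is injective, so a polynomial in C that kills v is zero.\<close>
  have "torsion_free W"
    using inj T by (intro W.torsion_freeI) auto
  then have "(\<Sum>j\<in>J. Polynomial.smult (b j) (L (J - {j}))) = 0"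
    using b(3) v unfolding torsion_free_def by auto
  \<comment> \<open>As in Lagrange interpolation, evaluation at k leaves the k-th summand
    only.\<close>
  then have "0 = poly (\<Sum>j\<in>J. Polynomial.smult (b j) (L (J - {j}))) k" by simp
  also have "\<dots> = (\<Sum>j\<in>J. b j * (\<Prod>l\<in>J-{j}. k - l))"
    by (simp add: poly_sum poly_prod L_def)
  also have "\<dots> = b k * (\<Prod>l\<in>J-{k}. k - l) + (\<Sum>j\<in>J-{k}. b j * (\<Prod>l\<in>J-{j}. k - l))"
    by (rule sum.remove[OF J(1) b(1)])
  also have "(\<Sum>j\<in>J-{k}. b j * (\<Prod>l\<in>J-{j}. k - l)) = 0"
    using b(1) J(1) by (intro sum.neutral) auto
  finally show False using b(2) J(1) by auto
qed

subsection \<open>Relations and finite rank\<close>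

lemma degree_map_poly_shift_le:
  "degree (map_poly (\<lambda>r. r \<circ>\<^sub>p [:a, 1:]) R) \<le> degree (R :: 'k::idom poly poly)"
  by (intro degree_le) (simp add: coeff_map_poly coeff_eq_0)

context zmod
begin

lemma diff_eq_0_iff: "x \<in> carrier V \<Longrightarrow> y \<in> carrier V \<Longrightarrow> x \<ominus> y = \<zero> \<longleftrightarrow> x = y"
  using eq_diff_iff[of x y \<zero>] by simp

text \<open>The converse of \<open>pact_semilin\<close>: undoing the shift lets \<open>T\<close> be
  taken out on the left.\<close>

lemma pact_shift:
  assumes T: "semilin a T" and x: "x \<in> carrier V"
  shows "pact T R (T x) = T (pact T (map_poly (\<lambda>r. r \<circ>\<^sub>p [:-a, 1:]) R) x)"
proof -
  have "map_poly (\<lambda>r. r \<circ>\<^sub>p [:a, 1:]) (map_poly (\<lambda>r. r \<circ>\<^sub>p [:-a, 1:]) R) = R"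
    by (subst map_poly_map_poly) (auto simp: pcompose_shift_shift o_def)
  then show ?thesis using pact_semilin[OF T x] by metis
qed

lemma pact_lincomb:
  assumes T: "semilin a T" and x: "x \<in> carrier V" and d: "\<And>i. i \<ge> d \<Longrightarrow> coeff Q i = 0"
  shows "pact T Q x = P.lincomb (map (coeff Q) [0..<d]) (map (\<lambda>i. (T ^^ i) x) [0..<d])"
  using x d
proof (induction d arbitrary: Q x)
  case 0
  then have "Q = 0" by (auto simp: poly_eq_iff)
  then show ?case by simp
next
  case (Suc d)
  obtain q Q' where Q: "Q = pCons q Q'" by (cases Q)
  have "coeff Q' i = 0" if "i \<ge> d" for i using Suc.prems(2)[of "Suc i"] that by (simp add: Q)
  then have "pact T Q' (T x) =
      P.lincomb (map (coeff Q') [0..<d]) (map (\<lambda>i. (T ^^ i) (T x)) [0..<d])"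
    using Suc.IH[of "T x" Q'] Suc.prems(1) semilinD(1)[OF T] by simp
  moreover have "[0..<Suc d] = 0 # map Suc [0..<d]"
    by (simp add: map_Suc_upt upt_conv_Cons)
  ultimately show ?case
    using Suc.prems(1) by (simp add: Q pact_pCons[OF T] o_def funpow_swap1 del: upt_Suc)
qed

text \<open>Finite rank with denominators cleared, which can be stated inside V. Where \<complex>(z)
  acts it is finite dimension, by \<open>Cz_fin_dim_iff\<close>.\<close>

definition bounded_rank :: bool where
  "bounded_rank \<longleftrightarrow> (\<exists>bs. set bs \<subseteq> carrier V \<and> (\<forall>x\<in>carrier V. \<exists>s ps. s \<noteq> 0 \<and>
     length ps = length bs \<and> s \<cdot> x = P.lincomb ps bs))"

text \<open>There is one more iterate \<open>(T ^^ j) x\<close> than there are generators; the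
  denominators \<open>s j\<close> are absorbed into the coefficients.\<close>

lemma bounded_rank_relation:
  assumes "bounded_rank" and T: "semilin a T" and x: "x \<in> carrier V"
  shows "\<exists>b n. (\<exists>j\<in>{..n}. b j \<noteq> 0) \<and> pact T (\<Sum>j\<in>{..n}. monom (b j) j) x = \<zero>"
proof -
  obtain bs where bs: "set bs \<subseteq> carrier V"
    "\<And>y. y \<in> carrier V \<Longrightarrow> \<exists>s ps. s \<noteq> 0 \<and> length ps = length bs \<and> s \<cdot> y = P.lincomb ps bs"
    using assms(1) unfolding bounded_rank_def by blast
  have "\<forall>j. \<exists>s ps. s \<noteq> 0 \<and> length ps = length bs \<and> s \<cdot> (T ^^ j) x = P.lincomb ps bs"
    using bs(2) pow_closed[OF T x] by blast
  then obtain s ps where s: "\<And>j. s j \<noteq> 0" "\<And>j. length (ps j) = length bs"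
    "\<And>j. s j \<cdot> (T ^^ j) x = P.lincomb (ps j) bs" by metis
  have "\<exists>b. (\<exists>j\<in>{..length bs}. b j \<noteq> 0) \<and>
      pact T (\<Sum>j\<in>{..length bs}. monom (b j * s j) j) x = \<zero>"
  proof (rule P.exists_relation[where act' = "\<lambda>b j. monom (b * s j) j" and bs = bs])
    fix j
    have "pact T (monom (b * s j) j) x = b \<cdot> P.lincomb (ps j) bs" for b
      using pow_closed[OF T x] by (simp add: pact_monom[OF T x] P.act_mult s(3))
    then show "\<exists>cs. length cs = length bs \<and> (\<forall>b. pact T (monom (b * s j) j) x = b \<cdot> P.lincomb cs bs)"
      using s(2) by blast
  qed (use bs pact_add[OF T x] in auto)
  then obtain b where "\<exists>j\<in>{..length bs}. b j \<noteq> 0"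
      "pact T (\<Sum>j\<in>{..length bs}. monom (b j * s j) j) x = \<zero>" by blast
  then show ?thesis using s(1) by (intro exI[of _ "\<lambda>j. b j * s j"] exI[of _ "length bs"]) auto
qed

end

lemma smult_sum_right: "Polynomial.smult c (\<Sum>j\<in>J. f j) = (\<Sum>j\<in>J. Polynomial.smult c (f j))"
  by (induction J rule: infinite_finite_induct) (auto simp: smult_add_right)

lemma coeff_sum_monom: "finite J \<Longrightarrow> j \<in> J \<Longrightarrow> coeff (\<Sum>j\<in>J. monom (b j) j) j = b j"
  by (simp add: coeff_sum)

section \<open>Relations in torsion free modules and injectivity of \<open>Lm\<close> and
  \<open>Lp\<close>\<close>

locale tfsl2 = sl2 +
  assumes tf: "torsion_free V"
begin

lemma polyact_eq_0: "x \<in> carrier V \<Longrightarrow> p \<noteq> 0 \<Longrightarrow> p \<cdot> x = \<zero> \<Longrightarrow> x = \<zero>"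
  using tf by (auto simp: torsion_free_def)

lemma polyact_cancel: "x \<in> carrier V \<Longrightarrow> y \<in> carrier V \<Longrightarrow> p \<noteq> 0 \<Longrightarrow> p \<cdot> x = p \<cdot> y \<Longrightarrow> x = y"
  using polyact_eq_0[of "x \<ominus> y" p] diff_eq_0_iff[of x y] diff_eq_0_iff[of "p \<cdot> x" "p \<cdot> y"]
  by (simp add: lin_endoD(6)[OF lin_polyact])

text \<open>If r_0 = 0, the relation can be written T (R'' x) = 0 with shifted coefficients.
  Injectivity removes \<open>T\<close>, and the degree has dropped.\<close>

lemma relation_coeff_0:
  assumes T: "semilin a T" and inj: "\<And>x. x \<in> carrier V \<Longrightarrow> T x = \<zero> \<Longrightarrow> x = \<zero>"
    and x: "x \<in> carrier V"
  shows "R \<noteq> 0 \<Longrightarrow> pact T R x = \<zero> \<Longrightarrow> \<exists>R. coeff R 0 \<noteq> 0 \<and> pact T R x = \<zero>"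
proof (induction "degree R" arbitrary: R rule: less_induct)
  case less
  show ?case
  proof (cases "coeff R 0 = 0")
    case True
    then obtain R' where R: "R = pCons 0 R'" by (cases R) auto
    define R'' where "R'' = map_poly (\<lambda>r. r \<circ>\<^sub>p [:-a, 1:]) R'"
    have "map_poly (\<lambda>r. r \<circ>\<^sub>p [:a, 1:]) R'' = R'"
      unfolding R''_def by (subst map_poly_map_poly) (auto simp: pcompose_shift_shift o_def)
    then have "R'' \<noteq> 0" using less.prems(1) by (auto simp: R)
    moreover have "degree R'' < degree R"
      using degree_map_poly_shift_le[of "-a" R'] less.prems(1) by (auto simp: R R''_def)
    moreover have "T (pact T R'' x) = \<zero>"
      using less.prems(2) x pact_shift[OF T x, of R'] semilinD(1)[OF T] pact_closed[OF T]
      by (simp add: R R''_def pact_pCons[OF T])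
    then have "pact T R'' x = \<zero>" using inj pact_closed[OF T x] by blast
    ultimately show ?thesis using less.hyps by blast
  qed (use less.prems in blast)
qed

text \<open>A kernel vector of \<open>T\<close> is a Casimir eigenvector, and its images under powers of \<open>S\<close> have
  pairwise distinct eigenvalues in \<open>\<complex>[z]\<close>, which bounded rank does not permit.\<close>

lemma injective_of_bounded_rank:
  assumes br: "bounded_rank" and S: "semilin (- a) S" and T: "semilin a T" and a: "a \<noteq> 0"
    and cS: "\<And>x. x \<in> carrier V \<Longrightarrow> cas (S x) = S (cas x)"
    and TS: "\<And>x. x \<in> carrier V \<Longrightarrow> T (S x) = [:0, a, 1:] \<cdot> x \<ominus> cas x"
    and ST: "\<And>x. x \<in> carrier V \<Longrightarrow> S (T x) = [:0, -a, 1:] \<cdot> x \<ominus> cas x"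
    and x: "x \<in> carrier V" "T x = \<zero>"
  shows "x = \<zero>"
proof (rule ccontr)
  assume x0: "x \<noteq> \<zero>"
  note [simp] = semilinD[OF S] semilinD(4)[OF T] pow_closed[OF S]
  have cx: "cas x = [:0, -a, 1:] \<cdot> x"
    using ST[OF x(1)] x diff_eq_0_iff[of "[:0, -a, 1:] \<cdot> x" "cas x"] by simp
  \<comment> \<open>The Casimir eigenvalue z^2 - a z of x, shifted k times by -a on its way past
    \<open>S\<close>. Its linear coefficient tells the different k apart.\<close>
  define lam where "lam k = [:0, -a, 1:] \<circ>\<^sub>p [:of_nat k * - a, 1:]" for k
  have lam1: "coeff (lam k) 1 = - (2 * of_nat k + 1) * a" for k
    by (simp add: lam_def pcompose_pCons algebra_simps)
  have lam_inj: "j = k" if "lam j = lam k" for j k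
    using lam1[of j] lam1[of k] a that by simp
  have pow_cas: "cas ((S ^^ k) x) = lam k \<cdot> (S ^^ k) x" for k
  proof -
    have "cas ((S ^^ k) x) = (S ^^ k) (cas x)"
      by (induction k) (use x cS in auto)
    then show ?thesis using x by (simp add: cx pow_polyact[OF S] lam_def)
  qed
  \<comment> \<open>If \<open>S\<close> killed \<open>(S ^^ k) x\<close>, then so would T S, which
    acts on this vector as a polynomial with linear coefficient (2 k + 2) a.\<close>
  have nz: "(S ^^ k) x \<noteq> \<zero>" for k
  proof (induction k)
    case (Suc k)
    show ?case
    proof
      assume "(S ^^ Suc k) x = \<zero>"
      then have "\<zero> = [:0, a, 1:] \<cdot> (S ^^ k) x \<ominus> lam k \<cdot> (S ^^ k) x"
        using TS[of "(S ^^ k) x"] x by (simp add: pow_cas)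
      also have "\<dots> = ([:0, a, 1:] - lam k) \<cdot> (S ^^ k) x"
        using x by (simp add: P.act_diff_left)
      finally have "([:0, a, 1:] - lam k) \<cdot> (S ^^ k) x = \<zero>" ..
      moreover have "coeff ([:0, a, 1:] - lam k) 1 = of_nat (2 * k + 2) * a"
        unfolding coeff_diff lam1 by (simp add: algebra_simps)
      then have "[:0, a, 1:] - lam k \<noteq> 0" using a
        by (metis coeff_0 mult_eq_0_iff of_nat_eq_0_iff add_eq_0_iff_both_eq_0 zero_neq_numeral)
      ultimately show False using Suc polyact_eq_0[of "(S ^^ k) x" "[:0, a, 1:] - lam k"] x by auto
    qed
  qed (use x0 in auto)
  have cas_pact: "cas (pact S (\<Sum>j\<in>J. monom (b j) j) x) = pact S (\<Sum>j\<in>J. monom (b j * lam j) j) x"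
    if "finite J" for J b
    using that by (induction J)
      (use x in \<open>auto simp: pact_add[OF S] pact_monom[OF S] pact_closed[OF S] cas_polyact pow_cas P.act_mult\<close>)
  \<comment> \<open>Independence of eigenvectors with distinct eigenvalues: applying the Casimir
    operator minus \<open>lam k\<close> removes the k-th term and multiplies the others by nonzero
    polynomials.\<close>
  have indep: "\<forall>j\<in>J. b j = 0" if "finite J" "pact S (\<Sum>j\<in>J. monom (b j) j) x = \<zero>" for J b
    using that
  proof (induction J arbitrary: b)
    case (insert k J)
    let ?R = "\<Sum>j\<in>insert k J. monom (b j) j"
    have "(\<Sum>j\<in>J. monom (b j * (lam j - lam k)) j) =
        (\<Sum>j\<in>insert k J. monom (b j * lam j) j) - Polynomial.smult (lam k) ?R"
      using insert.hyps
      by (simp add: smult_sum_right smult_monom smult_add_right sum_subtractf[symmetric]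
          algebra_simps diff_monom)
    then have "pact S (\<Sum>j\<in>J. monom (b j * (lam j - lam k)) j) x =
        cas (pact S ?R x) \<ominus> lam k \<cdot> pact S ?R x"
      using insert.hyps(1) x by (simp only: pact_diff[OF S] pact_smult[OF S] cas_pact finite_insert)
    then have "pact S (\<Sum>j\<in>J. monom (b j * (lam j - lam k)) j) x = \<zero>"
      using insert.prems by (simp add: C.minus_eq)
    then have J: "\<forall>j\<in>J. b j = 0" using insert.IH[of "\<lambda>j. b j * (lam j - lam k)"] lam_inj insert.hyps(2)
      by auto
    then have "(\<Sum>j\<in>J. monom (b j) j) = 0" by (intro sum.neutral) auto
    then have "b k \<cdot> (S ^^ k) x = \<zero>"
      using insert.prems insert.hyps x by (simp add: pact_monom[OF S])
    then have "b k = 0" using polyact_eq_0[of "(S ^^ k) x" "b k"] nz x by auto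
    then show ?case using J by auto
  qed simp
  show False using bounded_rank_relation[OF br S x(1)] indep by (metis finite_atMost)
qed

lemma Lm_injective: "bounded_rank \<Longrightarrow> x \<in> carrier V \<Longrightarrow> Lm V x = \<zero> \<Longrightarrow> x = \<zero>"
  by (rule injective_of_bounded_rank[where a = "-1" and S = "Lp V" and T = "Lm V"])
    (use semilin_Lm semilin_Lp in \<open>auto simp: cas_Lp Lm_Lp Lp_Lm\<close>)

lemma Lp_injective: "bounded_rank \<Longrightarrow> x \<in> carrier V \<Longrightarrow> Lp V x = \<zero> \<Longrightarrow> x = \<zero>"
  by (rule injective_of_bounded_rank[where a = "1" and S = "Lm V" and T = "Lp V"])
    (use semilin_Lm semilin_Lp in \<open>auto simp: cas_Lm Lm_Lp Lp_Lm\<close>)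

end

section \<open>Finite rank of simple torsion free modules\<close>

locale simple_tf = tfsl2 +
  fixes mu v
  assumes simple_V: "simple V" and cas_mu: "\<And>x. x \<in> carrier V \<Longrightarrow> cas x = mu \<odot> x"
    and v: "v \<in> carrier V" "v \<noteq> \<zero>"
begin

lemma Lm_Lp_mu: "x \<in> carrier V \<Longrightarrow> Lm V (Lp V x) = [:-mu, -1, 1:] \<cdot> x"
  and Lp_Lm_mu: "x \<in> carrier V \<Longrightarrow> Lp V (Lm V x) = [:-mu, 1, 1:] \<cdot> x"
  using P.act_diff_left[of x "[:0, -1, 1:]" "[:mu:]"] P.act_diff_left[of x "[:0, 1, 1:]" "[:mu:]"]
  by (auto simp: Lm_Lp Lp_Lm cas_mu)

text \<open>\<open>Lp\<close> after \<open>Lm\<close> acts as the nonzero polynomial z^2 + z - mu,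
  which is injective by torsion freeness.\<close>

lemma Lm_inj: "x \<in> carrier V \<Longrightarrow> Lm V x = \<zero> \<Longrightarrow> x = \<zero>"
  using Lp_Lm_mu[of x] polyact_eq_0[of x "[:-mu, 1, 1:]"] by simp

lemmas pact_Lm [simp] = pact_closed[OF semilin_Lm] pow_closed[OF semilin_Lm]

text \<open>The submodule generated by \<open>z v\<close> contains \<open>v\<close>. If the \<open>Lm\<^sup>i v\<close> were independent, then applying
  \<open>Lm\<^sup>n\<close> to an element of this submodule would, for large \<open>n\<close>, give a combination whose coefficient
  at \<open>Lm\<^sup>i v\<close> vanishes at \<open>z = i\<close>.\<close>

lemma Lm_relation: "\<exists>R. R \<noteq> 0 \<and> pact (Lm V) R v = \<zero>"
proof -
  \<comment> \<open>The shift that accompanies \<open>Lm\<close> moves the root i of the i-th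
    coefficient to i + 1, so the condition survives an application of \<open>Lm\<close>.\<close>
  define D where "D R \<longleftrightarrow> (\<forall>i. [:- of_nat i, 1:] dvd coeff R i)" for R :: "complex poly poly"
  define Y where "Y = {pact (Lm V) R v | R. D R}"
  \<comment> \<open>Allowing a power of \<open>Lm\<close> in front gives stability under
    \<open>Lp\<close>, since \<open>Lm\<close> after \<open>Lp\<close> is a polynomial.\<close>
  define N where "N = {x \<in> carrier V. \<exists>n. (Lm V ^^ n) x \<in> Y}"
  have Y_add: "x \<oplus> y \<in> Y" if "x \<in> Y" "y \<in> Y" for x y
  proof -
    from that obtain R S where "D R" "D S" "x = pact (Lm V) R v" "y = pact (Lm V) S v"
      by (auto simp: Y_def)
    then have "D (R + S)" "x \<oplus> y = pact (Lm V) (R + S) v"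
      using v by (auto simp: D_def pact_add[OF semilin_Lm])
    then show ?thesis by (auto simp: Y_def)
  qed
  have Y_poly: "p \<cdot> x \<in> Y" if "x \<in> Y" for x p
  proof -
    from that obtain R where "D R" "x = pact (Lm V) R v" by (auto simp: Y_def)
    then have "D (Polynomial.smult p R)" "p \<cdot> x = pact (Lm V) (Polynomial.smult p R) v"
      using v by (auto simp: D_def pact_smult[OF semilin_Lm])
    then show ?thesis unfolding Y_def by blast
  qed
  have Y_Lm: "Lm V x \<in> Y" if "x \<in> Y" for x
  proof -
    from that obtain R where R: "D R" "x = pact (Lm V) R v" by (auto simp: Y_def)
    define R' where "R' = pCons 0 (map_poly (\<lambda>r. r \<circ>\<^sub>p [:-1, 1:]) R)"
    have "[:- of_nat (Suc i), 1:] dvd coeff R i \<circ>\<^sub>p [:-1, 1:]" for i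
    proof -
      from R(1) obtain q where "coeff R i = [:- of_nat i, 1:] * q" by (auto simp: D_def dvd_def)
      then have "coeff R i \<circ>\<^sub>p [:-1, 1:] = [:- of_nat (Suc i), 1:] * (q \<circ>\<^sub>p [:-1, 1:])"
        by (simp only: pcompose_mult) (simp add: pcompose_pCons algebra_simps)
      then show ?thesis by (metis dvd_triv_left)
    qed
    then have "D R'" unfolding D_def R'_def by (auto simp: coeff_pCons coeff_map_poly split: nat.split)
    moreover have "Lm V x = pact (Lm V) R' v"
      using v by (simp add: R(2) R'_def pact_semilin[OF semilin_Lm] pact_pCons[OF semilin_Lm])
    ultimately show ?thesis unfolding Y_def by blast
  qed
  have Y_pow: "(Lm V ^^ n) x \<in> Y" if "x \<in> Y" for x n
    using that by (induction n) (auto intro: Y_Lm)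
  have N_poly: "p \<cdot> x \<in> N" if "x \<in> N" for x p
  proof -
    from that obtain n where "x \<in> carrier V" "(Lm V ^^ n) x \<in> Y" by (auto simp: N_def)
    then have "p \<cdot> x \<in> carrier V" "(Lm V ^^ n) (p \<cdot> x) \<in> Y"
      by (auto simp: pow_polyact[OF semilin_Lm] Y_poly)
    then show ?thesis by (auto simp: N_def)
  qed
  have "sl2_submod V N"
    unfolding sl2_submod_def
  proof (intro conjI allI ballI)
    have "\<zero> = pact (Lm V) 0 v" "D 0" by (auto simp: D_def)
    then have "\<zero> \<in> Y" unfolding Y_def by blast
    then show "\<zero> \<in> N" unfolding N_def by (auto intro!: exI[of _ "0::nat"])
  next
    fix x y assume xy: "x \<in> N" "y \<in> N"
    from xy obtain n where n: "x \<in> carrier V" "(Lm V ^^ n) x \<in> Y" by (auto simp: N_def)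
    from xy obtain m where m: "y \<in> carrier V" "(Lm V ^^ m) y \<in> Y" by (auto simp: N_def)
    have lin: "(Lm V ^^ k) (x \<oplus> y) = (Lm V ^^ k) x \<oplus> (Lm V ^^ k) y" for k
      by (induction k) (use n m in auto)
    have "(Lm V ^^ (n + m)) x \<in> Y"
      using Y_pow[OF n(2), of m] by (metis add.commute comp_apply funpow_add)
    moreover have "(Lm V ^^ (n + m)) y \<in> Y"
      using Y_pow[OF m(2), of n] by (metis comp_apply funpow_add)
    ultimately show "x \<oplus> y \<in> N" using n m lin Y_add by (auto simp: N_def intro!: exI[of _ "n + m"])
  next
    fix c x assume x: "x \<in> N"
    then show "c \<odot> x \<in> N" using N_poly[of x "[:c:]"] by (simp add: N_def)
    show "L0 V x \<in> N" using x N_poly[of x "[:0, 1:]"] by (simp add: N_def)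
    from x obtain n where n: "x \<in> carrier V" "(Lm V ^^ n) x \<in> Y" by (auto simp: N_def)
    have "(Lm V ^^ n) (Lm V x) \<in> Y" using Y_Lm[OF n(2)] by (simp add: funpow_swap1)
    then show "Lm V x \<in> N" using n by (auto simp: N_def)
    have "(Lm V ^^ Suc n) (Lp V x) = (Lm V ^^ n) ([:-mu, -1, 1:] \<cdot> x)"
      using n Lm_Lp_mu by (simp add: funpow_swap1)
    then have "(Lm V ^^ Suc n) (Lp V x) \<in> Y"
      using n Y_poly by (simp only: pow_polyact[OF semilin_Lm])
    then show "Lp V x \<in> N"
      using n by (auto simp: N_def simp del: funpow.simps intro!: exI[of _ "Suc n"])
  qed (auto simp: N_def)
  moreover have "L0 V v \<in> N"
  proof -
    have "D [:[:0, 1:]:]" by (auto simp: D_def coeff_pCons split: nat.split)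
    moreover have "L0 V v = pact (Lm V) [:[:0, 1:]:] v" using v by (simp add: pact_pCons[OF semilin_Lm])
    ultimately have "L0 V v \<in> Y" unfolding Y_def by blast
    then show ?thesis using v unfolding N_def by (auto intro!: exI[of _ "0::nat"])
  qed
  moreover have "L0 V v \<noteq> \<zero>" using v polyact_eq_0[of v "[:0, 1:]"] by auto
  ultimately have "N = carrier V" using simple_V unfolding simple_def by blast
  then have "v \<in> N" using v by simp
  then obtain n R where R: "D R" "(Lm V ^^ n) v = pact (Lm V) R v" by (auto simp: N_def Y_def)
  have "pact (Lm V) (monom 1 n - R) v = \<zero>"
    using v R by (simp add: pact_diff[OF semilin_Lm] pact_monom[OF semilin_Lm] C.minus_eq C.r_neg)
  \<comment> \<open>The n-th coefficient of \<open>R\<close> vanishes at z = n and hence is not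
    1.\<close>
  moreover have "coeff (monom 1 n - R) n \<noteq> 0"
  proof
    assume "coeff (monom 1 n - R) n = 0"
    then have "coeff R n = 1" by simp
    then have "[:- of_nat n, 1:] dvd (1 :: complex poly)" using R(1) unfolding D_def by metis
    then show False by (auto simp: is_unit_iff_degree)
  qed
  then have "monom 1 n - R \<noteq> 0" by auto
  ultimately show ?thesis by blast
qed

text \<open>The vectors with a nonzero multiple in the \<complex>[z]-span of v, ...,
  \<open>Lm\<close>^(d-1) v form a submodule: the leading coefficient of a relation of degree d
  keeps \<open>Lm\<close> inside, and r_0 \<noteq> 0 keeps \<open>Lp\<close> inside.\<close>

theorem bounded_rank_simple: "bounded_rank"
proof -
  obtain R0 where "R0 \<noteq> 0" "pact (Lm V) R0 v = \<zero>" using Lm_relation by blast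
  then obtain R where R: "coeff R 0 \<noteq> 0" "pact (Lm V) R v = \<zero>"
    using relation_coeff_0[OF semilin_Lm Lm_inj v(1)] by blast
  define d where "d = degree R"
  have R0: "R \<noteq> 0" using R by auto
  have d: "d > 0"
  proof (rule ccontr)
    assume "\<not> d > 0"
    then obtain r where "R = [:r:]" by (auto simp: d_def elim: degree_eq_zeroE)
    then show False using R v polyact_eq_0[of v r] by (simp add: pact_pCons[OF semilin_Lm])
  qed
  define X where "X = {x \<in> carrier V. \<exists>s Q. s \<noteq> 0 \<and> degree Q < d \<and> s \<cdot> x = pact (Lm V) Q v}"
  have XI: "x \<in> X" if "x \<in> carrier V" "s \<noteq> 0" "degree Q \<le> d" "s \<cdot> x = pact (Lm V) Q v" for x s Q
  proof -
    define Q' where "Q' = Polynomial.smult (lead_coeff R) Q - Polynomial.smult (coeff Q d) R"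
    have "degree Q' \<le> d" unfolding Q'_def
      using that(3) by (intro degree_diff_le order_trans[OF degree_smult_le]) (auto simp: d_def)
    moreover have "coeff Q' d = 0" by (simp add: Q'_def d_def)
    ultimately have "degree Q' < d" using d eq_zero_or_degree_less by force
    moreover have "(lead_coeff R * s) \<cdot> x = pact (Lm V) Q' v"
      using that v R by (simp add: Q'_def pact_diff[OF semilin_Lm] pact_smult[OF semilin_Lm]
        P.act_mult C.minus_eq)
    moreover have "lead_coeff R * s \<noteq> 0" using R0 that by simp
    ultimately show ?thesis using that(1) unfolding X_def by blast
  qed
  have X_closed: "x \<in> carrier V" if "x \<in> X" for x using that by (auto simp: X_def)
  have X_pact: "pact (Lm V) Q v \<in> X" if "degree Q < d" for Q
    using that v unfolding X_def by (auto intro!: exI[of _ "1::complex poly"])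
  have X_add: "x \<oplus> y \<in> X" if xy: "x \<in> X" "y \<in> X" for x y
  proof -
    from xy obtain s Q where 1: "s \<noteq> 0" "degree Q < d" "s \<cdot> x = pact (Lm V) Q v" by (auto simp: X_def)
    from xy obtain t S where 2: "t \<noteq> 0" "degree S < d" "t \<cdot> y = pact (Lm V) S v" by (auto simp: X_def)
    have "(t * s) \<cdot> (x \<oplus> y) = t \<cdot> s \<cdot> x \<oplus> s \<cdot> t \<cdot> y"
      using X_closed xy by (simp add: P.act_add_right P.act_mult P.act_commute)
    also have "\<dots> = pact (Lm V) (Polynomial.smult t Q + Polynomial.smult s S) v"
      using v 1 2 by (simp add: pact_add[OF semilin_Lm] pact_smult[OF semilin_Lm])
    finally show ?thesis
      using 1 2 X_closed xy by (intro XI[of _ "t * s" "Polynomial.smult t Q + Polynomial.smult s S"])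
        (auto intro!: degree_add_le order_trans[OF degree_smult_le])
  qed
  have X_poly: "p \<cdot> x \<in> X" if x: "x \<in> X" for x p
  proof -
    from x obtain s Q where 1: "s \<noteq> 0" "degree Q < d" "s \<cdot> x = pact (Lm V) Q v" by (auto simp: X_def)
    have "s \<cdot> p \<cdot> x = p \<cdot> s \<cdot> x" using X_closed[OF x] by (rule P.act_commute)
    then show ?thesis using 1 v X_closed[OF x]
      by (intro XI[of _ s "Polynomial.smult p Q"])
        (auto simp: pact_smult[OF semilin_Lm] intro!: order_trans[OF degree_smult_le])
  qed
  have X_sat: "x \<in> X" if "x \<in> carrier V" "p \<noteq> 0" "p \<cdot> x \<in> X" for x p
  proof -
    from that(3) obtain s Q where 1: "s \<noteq> 0" "degree Q < d" "s \<cdot> p \<cdot> x = pact (Lm V) Q v"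
      by (auto simp: X_def)
    then show ?thesis using that by (intro XI[of _ "s * p" Q]) (auto simp: P.act_mult)
  qed
  have X_Lm: "Lm V x \<in> X" if x: "x \<in> X" for x
  proof -
    from x obtain s Q where 1: "s \<noteq> 0" "degree Q < d" "s \<cdot> x = pact (Lm V) Q v" by (auto simp: X_def)
    define Q' where "Q' = pCons 0 (map_poly (\<lambda>r. r \<circ>\<^sub>p [:-1, 1:]) Q)"
    have "degree Q' \<le> d" unfolding Q'_def
      using 1(2) degree_map_poly_shift_le[of "-1" Q] by (auto simp: degree_pCons_eq_if)
    moreover have "(s \<circ>\<^sub>p [:-1, 1:]) \<cdot> Lm V x = pact (Lm V) Q' v"
      using X_closed[OF x] v semilin_polyact[OF semilin_Lm, of x s]
      by (simp add: 1(3) Q'_def pact_semilin[OF semilin_Lm] pact_pCons[OF semilin_Lm])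
    ultimately show ?thesis using 1 X_closed[OF x]
      by (intro XI[of _ "s \<circ>\<^sub>p [:-1, 1:]" Q']) auto
  qed
  \<comment> \<open>Taking \<open>Lm\<close> out in front of all terms but the first prepares for
    \<open>Lp\<close>, because \<open>Lp\<close> after \<open>Lm\<close> is a polynomial.\<close>
  have split: "\<exists>Q'. degree Q' < d \<and> pact (Lm V) (pCons q Q) v = q \<cdot> v \<oplus> Lm V (pact (Lm V) Q' v)"
    if "degree Q < d" for q Q
    using that v degree_map_poly_shift_le[of 1 Q] pact_shift[OF semilin_Lm v(1), of Q]
    by (intro exI[of _ "map_poly (\<lambda>r. r \<circ>\<^sub>p [:1, 1:]) Q"]) (auto simp: pact_pCons[OF semilin_Lm])
  have X_LpLm: "Lp V (Lm V (pact (Lm V) Q v)) \<in> X" if "degree Q < d" for Q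
    using X_poly[OF X_pact[OF that]] v by (simp add: Lp_Lm_mu)
  \<comment> \<open>The relation reads r_0 v = - \<open>Lm\<close> u with u in \<open>X\<close>, so
    \<open>Lp\<close> sends r_0 v into \<open>X\<close>; the shifted r_0 is nonzero and is divided
    off by \<open>X_sat\<close>.\<close>
  have Lpv: "Lp V v \<in> X"
  proof -
    obtain r R' where R': "R = pCons r R'" by (cases R)
    then have "degree R' < d" using d by (auto simp: d_def degree_pCons_eq_if split: if_splits)
    then obtain Q where Q: "degree Q < d" "\<zero> = r \<cdot> v \<oplus> Lm V (pact (Lm V) Q v)"
      using split[of R' r] R(2) R' by auto
    then have "r \<cdot> v = \<ominus> Lm V (pact (Lm V) Q v)"
      using v by (intro C.minus_equality[symmetric]) auto
    then have "Lp V (r \<cdot> v) = [:-1:] \<cdot> Lp V (Lm V (pact (Lm V) Q v))"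
      using v by (simp add: minus_eq_smult)
    then have "(r \<circ>\<^sub>p [:1, 1:]) \<cdot> Lp V v \<in> X"
      using X_poly[OF X_LpLm[OF Q(1)]] v semilin_polyact[OF semilin_Lp, of v r] by metis
    then show ?thesis using X_sat[of "Lp V v" "r \<circ>\<^sub>p [:1, 1:]"] v R(1) R' by auto
  qed
  have X_Lp: "Lp V x \<in> X" if x: "x \<in> X" for x
  proof -
    from x obtain s Q where 1: "s \<noteq> 0" "degree Q < d" "s \<cdot> x = pact (Lm V) Q v" by (auto simp: X_def)
    obtain q Q' where Q': "Q = pCons q Q'" by (cases Q)
    then have "degree Q' < d" using 1(2) by (auto simp: degree_pCons_eq_if split: if_splits)
    then obtain S where S: "degree S < d" "s \<cdot> x = q \<cdot> v \<oplus> Lm V (pact (Lm V) S v)"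
      using split[of Q' q] 1(3) Q' by auto
    have "(s \<circ>\<^sub>p [:1, 1:]) \<cdot> Lp V x = Lp V (s \<cdot> x)"
      using X_closed[OF x] by (simp add: semilin_polyact[OF semilin_Lp])
    also have "\<dots> = (q \<circ>\<^sub>p [:1, 1:]) \<cdot> Lp V v \<oplus> Lp V (Lm V (pact (Lm V) S v))"
      unfolding S(2) using v by (simp add: semilin_polyact[OF semilin_Lp])
    also have "\<dots> \<in> X" by (intro X_add X_poly Lpv X_LpLm S)
    finally show ?thesis using X_sat[of "Lp V x" "s \<circ>\<^sub>p [:1, 1:]"] X_closed[OF x] 1 by auto
  qed
  have "sl2_submod V X"
    unfolding sl2_submod_def
  proof (intro conjI allI ballI)
    show "\<zero> \<in> X" using X_pact[of 0] d by simp
    show "c \<odot> x \<in> X" if "x \<in> X" for c x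
      using X_poly[OF that, of "[:c:]"] X_closed[OF that] by simp
    show "L0 V x \<in> X" if "x \<in> X" for x
      using X_poly[OF that, of "[:0, 1:]"] X_closed[OF that] by simp
  qed (auto intro: X_closed X_add X_Lm X_Lp)
  moreover have "v \<in> X"
    using X_pact[of "[:1:]"] d v by (simp add: pact_pCons[OF semilin_Lm])
  ultimately have X: "X = carrier V" using simple_V v unfolding simple_def by blast
  define bs where "bs = map (\<lambda>i. (Lm V ^^ i) v) [0..<d]"
  have "\<exists>s ps. s \<noteq> 0 \<and> length ps = length bs \<and> s \<cdot> x = P.lincomb ps bs" if "x \<in> carrier V" for x
  proof -
    from that X have "x \<in> X" by simp
    then obtain s Q where 1: "s \<noteq> 0" "degree Q < d" "s \<cdot> x = pact (Lm V) Q v" by (auto simp: X_def)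
    have "pact (Lm V) Q v = P.lincomb (map (coeff Q) [0..<d]) bs"
      unfolding bs_def using 1(2) by (intro pact_lincomb[OF semilin_Lm v(1)] coeff_eq_0) simp
    then show ?thesis using 1 by (intro exI[of _ s] exI[of _ "map (coeff Q) [0..<d]"]) (auto simp: bs_def)
  qed
  moreover have "set bs \<subseteq> carrier V" using v by (auto simp: bs_def)
  ultimately show ?thesis unfolding bounded_rank_def by blast
qed

end

subsection \<open>Rational modules and rationalization\<close>

locale ratz = zmod +
  assumes bij: "\<And>p. p \<noteq> 0 \<Longrightarrow> bij_betw (polyact V p) (carrier V) (carrier V)"
begin

lemma rat_cancel: "p \<noteq> 0 \<Longrightarrow> x \<in> carrier V \<Longrightarrow> y \<in> carrier V \<Longrightarrow> p \<cdot> x = p \<cdot> y \<Longrightarrow> x = y"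
  using bij[of p] by (rule_tac inj_onD[of "polyact V p" "carrier V"]) (auto simp: bij_betw_def)

lemma rat_torsion_free: "torsion_free V"
  unfolding torsion_free_def
proof (intro allI impI ballI)
  fix p v assume "p \<noteq> 0" "v \<in> carrier V" "p \<cdot> v = \<zero>"
  then show "v = \<zero>" by (rule_tac rat_cancel[of p]) auto
qed

lemma rat_divide:
  assumes "p \<noteq> 0" "x \<in> carrier V" obtains y where "y \<in> carrier V" "p \<cdot> y = x"
proof -
  have "x \<in> polyact V p ` carrier V" using bij[OF assms(1)] assms(2) by (simp add: bij_betw_def)
  then show ?thesis using that by auto
qed

text \<open>The pair picked by \<open>SOME\<close> may differ from (p, q). The equation q y = p x
  determines y and holds for every choice.\<close>

lemma cz_Fract_aux:
  assumes q: "q \<noteq> 0" and x: "x \<in> carrier V"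
  shows "cz_smult V (Fract p q) x \<in> carrier V \<and> q \<cdot> cz_smult V (Fract p q) x = p \<cdot> x"
proof -
  define Q where "Q = (\<lambda>(p', q'). q' \<noteq> 0 \<and> Fract p q = Fract p' q')"
  have "Q (p, q)" using q by (simp add: Q_def)
  then have Q: "Q (Eps Q)" by (rule someI)
  obtain p' q' where eq: "Eps Q = (p', q')" by (cases "Eps Q")
  then have q': "q' \<noteq> 0" and pq: "p * q' = p' * q" using Q q by (auto simp: Q_def eq_fract)
  define y where "y = the_inv_into (carrier V) (polyact V q') x"
  have y: "y \<in> carrier V" "q' \<cdot> y = x"
  proof -
    have inj: "inj_on (polyact V q') (carrier V)" and im: "x \<in> polyact V q' ` carrier V"
      using bij[OF q'] x by (simp_all add: bij_betw_def)
    show "y \<in> carrier V" unfolding y_def by (rule the_inv_into_into[OF inj im order_refl])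
    show "q' \<cdot> y = x" unfolding y_def by (rule f_the_inv_into_f[OF inj im])
  qed
  have "cz_smult V (Fract p q) x = p' \<cdot> y"
    unfolding cz_smult_def Q_def[symmetric] eq by (simp add: y_def)
  moreover have "q \<cdot> p' \<cdot> y = p \<cdot> x"
  proof -
    have "q \<cdot> p' \<cdot> y = (q * p') \<cdot> y" using y(1) by (simp add: P.act_mult)
    also have "q * p' = p * q'" by (simp only: pq mult.commute[of q])
    also have "(p * q') \<cdot> y = p \<cdot> x" using y by (simp add: P.act_mult)
    finally show ?thesis .
  qed
  ultimately show ?thesis using y by simp
qed

lemma cz_closed [simp]: "x \<in> carrier V \<Longrightarrow> cz_smult V r x \<in> carrier V"
proof -
  obtain p q where "r = Fract p q" "q \<noteq> 0" by (cases r)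
  then show "x \<in> carrier V \<Longrightarrow> cz_smult V r x \<in> carrier V" using cz_Fract_aux[of q x p] by blast
qed

lemma cz_Fract: "q \<noteq> 0 \<Longrightarrow> x \<in> carrier V \<Longrightarrow> q \<cdot> cz_smult V (Fract p q) x = p \<cdot> x"
  using cz_Fract_aux[of q x p] by blast

lemma cz_eqI: "q \<noteq> 0 \<Longrightarrow> x \<in> carrier V \<Longrightarrow> y \<in> carrier V \<Longrightarrow> q \<cdot> y = p \<cdot> x \<Longrightarrow>
    cz_smult V (Fract p q) x = y"
  by (rule rat_cancel[of q]) (auto simp: cz_Fract)

end

text \<open>Each law is checked after multiplication by a common denominator, which is cancelled by
  injectivity.\<close>

sublocale ratz \<subseteq> Z: kmod V "cz_smult V"
proof (intro kmod.intro kmod_axioms.intro)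
  fix r s :: "complex poly fract" and x assume x: "x \<in> carrier V"
  obtain p q where r: "r = Fract p q" "q \<noteq> 0" by (cases r)
  obtain p' q' where s: "s = Fract p' q'" "q' \<noteq> 0" by (cases s)
  define y z where "y = cz_smult V r x" and "z = cz_smult V s x"
  have yz: "q \<cdot> y = p \<cdot> x" "q' \<cdot> z = p' \<cdot> x" "y \<in> carrier V" "z \<in> carrier V"
    using x r s by (auto simp: y_def z_def cz_Fract)
  have "(q * q') \<cdot> (y \<oplus> z) = q' \<cdot> q \<cdot> y \<oplus> q \<cdot> q' \<cdot> z"
    using yz P.act_mult[of y q' q] P.act_mult[of z q q'] by (simp add: P.act_add_right mult.commute)
  also have "\<dots> = (p * q' + p' * q) \<cdot> x"
    unfolding yz(1,2) using x by (simp add: P.act_add_left P.act_mult[symmetric] mult.commute)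
  finally have sum: "(q * q') \<cdot> (y \<oplus> z) = (p * q' + p' * q) \<cdot> x" .
  have rs: "r + s = Fract (p * q' + p' * q) (q * q')" using r s by simp
  have "cz_smult V (r + s) x = y \<oplus> z"
    unfolding rs using sum by (rule cz_eqI[rotated 3]) (use r s x yz in auto)
  then show "cz_smult V (r + s) x = cz_smult V r x \<oplus> cz_smult V s x"
    by (simp only: y_def z_def)
  have w: "cz_smult V r z \<in> carrier V" "q \<cdot> cz_smult V r z = p \<cdot> z"
    using yz r by (auto simp: cz_Fract)
  have "(q * q') \<cdot> cz_smult V r z = q' \<cdot> q \<cdot> cz_smult V r z"
    using w P.act_mult[of "cz_smult V r z" q' q] by (simp add: mult.commute)
  also have "\<dots> = p \<cdot> q' \<cdot> z" unfolding w(2) using yz(4) by (rule P.act_commute)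
  also have "\<dots> = (p * p') \<cdot> x" unfolding yz(2) using x by (simp add: P.act_mult)
  finally have prod: "(q * q') \<cdot> cz_smult V r z = (p * p') \<cdot> x" .
  have rs: "r * s = Fract (p * p') (q * q')" using r s by simp
  have "cz_smult V (r * s) x = cz_smult V r z"
    unfolding rs using prod by (rule cz_eqI[rotated 3]) (use r s x w in auto)
  then show "cz_smult V (r * s) x = cz_smult V r (cz_smult V s x)"
    by (simp only: z_def)
  fix x' assume x': "x' \<in> carrier V"
  show "cz_smult V r (x \<oplus> x') = cz_smult V r x \<oplus> cz_smult V r x'"
    unfolding r(1) using x x' r(2) by (intro cz_eqI) (auto simp: P.act_add_right cz_Fract)
next
  fix x assume "x \<in> carrier V" then show "cz_smult V 1 x = x"
    unfolding One_fract_def by (intro cz_eqI) auto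
qed (auto simp: C.abelian_group_axioms)

context ratz
begin

lemma module_Cz: "module CZ (Cz_module V)"
proof -
  have "abelian_group (Cz_module V)"
  proof (rule abelian_groupI)
    fix x assume "x \<in> carrier (Cz_module V)"
    then show "\<exists>y\<in>carrier (Cz_module V). y \<oplus>\<^bsub>Cz_module V\<^esub> x = \<zero>\<^bsub>Cz_module V\<^esub>"
      by (intro bexI[of _ "\<ominus> x"]) (auto simp: Cz_module_def C.l_neg)
  qed (auto simp: Cz_module_def C.a_ac)
  then show ?thesis
    using univ_cring[where 'k = "complex poly fract"]
    by (auto simp: module_def module_axioms_def CZ_def Cz_module_def Z.act_add_left Z.act_add_right
      Z.act_mult)
qed

text \<open>A common denominator turns a combination over \<complex>(z) into one over \<complex>[z];
  conversely the coefficients are divided by s.\<close>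

lemma Cz_fin_dim_iff: "Cz_fin_dim V \<longleftrightarrow> bounded_rank"
proof
  have den: "\<exists>s ps. s \<noteq> 0 \<and> length ps = length bs \<and> s \<cdot> Z.lincomb cs bs = P.lincomb ps bs"
    if "length cs = length bs" "set bs \<subseteq> carrier V" for cs bs
    using that
  proof (induction cs bs rule: list_induct2)
    case Nil show ?case by (intro exI[of _ 1] exI[of _ "[]"]) simp
  next
    case (Cons r cs b bs)
    then obtain s ps where s: "s \<noteq> 0" "length ps = length bs" "s \<cdot> Z.lincomb cs bs = P.lincomb ps bs"
      by auto
    obtain p q where r: "r = Fract p q" "q \<noteq> 0" by (cases r)
    have "(q * s) \<cdot> Z.lincomb (r # cs) (b # bs) = s \<cdot> q \<cdot> cz_smult V r b \<oplus> q \<cdot> s \<cdot> Z.lincomb cs bs"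
      using Cons.prems by (simp add: P.act_add_right P.act_mult[symmetric] mult.commute)
    also have "\<dots> = P.lincomb ((s * p) # map ((*) q) ps) (b # bs)"
      using Cons.prems s r by (simp add: cz_Fract P.act_mult P.act_lincomb)
    finally have "(q * s) \<cdot> Z.lincomb (r # cs) (b # bs) = P.lincomb ((s * p) # map ((*) q) ps) (b # bs)" .
    moreover have "q * s \<noteq> 0" "length ((s * p) # map ((*) q) ps) = length (b # bs)" using s r by auto
    ultimately show ?case by blast
  qed
  assume "Cz_fin_dim V"
  then obtain bs where bs: "set bs \<subseteq> carrier V"
    "\<And>v. v \<in> carrier V \<Longrightarrow> \<exists>cs. length cs = length bs \<and> v = Z.lincomb cs bs"
    unfolding Cz_fin_dim_def Z.lincomb_def by blast
  have "\<exists>s ps. s \<noteq> 0 \<and> length ps = length bs \<and> s \<cdot> x = P.lincomb ps bs" if x: "x \<in> carrier V" for x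
  proof -
    obtain cs where cs: "length cs = length bs" "x = Z.lincomb cs bs" using bs(2)[OF x] by blast
    show ?thesis using den[OF cs(1) bs(1)] unfolding cs(2) .
  qed
  then show bounded_rank unfolding bounded_rank_def using bs(1) by blast
next
  assume bounded_rank
  then obtain bs where bs: "set bs \<subseteq> carrier V"
    "\<And>x. x \<in> carrier V \<Longrightarrow> \<exists>s ps. s \<noteq> 0 \<and> length ps = length bs \<and> s \<cdot> x = P.lincomb ps bs"
    unfolding bounded_rank_def by blast
  have "\<exists>cs. length cs = length bs \<and> x = Z.lincomb cs bs" if xV: "x \<in> carrier V" for x
  proof -
    obtain s ps where s: "s \<noteq> 0" "length ps = length bs" "s \<cdot> x = P.lincomb ps bs"
      using bs(2)[OF xV] by blast
    have "s \<cdot> Z.lincomb (map (\<lambda>p. Fract p s) ps) bs = P.lincomb ps bs"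
      using s(2) bs(1) by (induction ps bs rule: list_induct2)
        (auto simp: P.act_add_right cz_Fract s(1))
    then have "x = Z.lincomb (map (\<lambda>p. Fract p s) ps) bs"
      using s(3) by (rule_tac rat_cancel[OF s(1) xV]) (use bs(1) in auto)
    then show ?thesis using s(2) by (intro exI[of _ "map (\<lambda>p. Fract p s) ps"]) simp
  qed
  then show "Cz_fin_dim V" using bs(1) unfolding Cz_fin_dim_def Z.lincomb_def by blast
qed

end

section \<open>Rational sl(2)-modules and their subobjects\<close>

locale ratsl2 = sl2 + ratz

sublocale ratsl2 \<subseteq> tfsl2
  by unfold_locales (rule rat_torsion_free)

lemma rational_iff: "rational V \<longleftrightarrow> ratsl2 V \<and> zmod.bounded_rank V"
proof
  assume R: "rational V"
  then interpret sl2 V by unfold_locales (simp add: rational_def)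
  interpret ratz V using R by unfold_locales (simp add: rational_def)
  show "ratsl2 V \<and> bounded_rank"
    using R Cz_fin_dim_iff by (auto simp: rational_def ratsl2_def sl2_axioms ratz_axioms)
next
  assume R: "ratsl2 V \<and> zmod.bounded_rank V"
  then interpret ratsl2 V by simp
  show "rational V" using R is_sl2 bij module_Cz Cz_fin_dim_iff by (simp add: rational_def)
qed

context ratsl2
begin

text \<open>A submodule is stable under \<complex>[z] through \<open>L0\<close>, so stability under
  \<complex>(z) comes down to division by nonzero polynomials.\<close>

lemma R_sub_iff: "R_sub V U \<longleftrightarrow>
  sl2_submod V U \<and> (\<forall>p x. p \<noteq> 0 \<longrightarrow> x \<in> carrier V \<longrightarrow> p \<cdot> x \<in> U \<longrightarrow> x \<in> U)"
proof (intro iffI conjI allI impI)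
  assume U: "R_sub V U"
  then show "sl2_submod V U" by (simp add: R_sub_def)
  fix p x assume *: "p \<noteq> 0" "x \<in> carrier V" "p \<cdot> x \<in> U"
  have "cz_smult V (Fract 1 p) (p \<cdot> x) \<in> U" using U *(3) by (simp add: R_sub_def)
  moreover have "cz_smult V (Fract 1 p) (p \<cdot> x) = x" using * by (rule_tac cz_eqI) auto
  ultimately show "x \<in> U" by simp
next
  assume U: "sl2_submod V U \<and> (\<forall>p x. p \<noteq> 0 \<longrightarrow> x \<in> carrier V \<longrightarrow> p \<cdot> x \<in> U \<longrightarrow> x \<in> U)"
  have "cz_smult V r x \<in> U" if x: "x \<in> U" for r x
  proof -
    have xV: "x \<in> carrier V" using submodD(1) U x by blast
    obtain p q where r: "r = Fract p q" "q \<noteq> 0" by (cases r)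
    have "q \<cdot> cz_smult V r x \<in> U"
      using submod_polyact[of U x p] U x by (simp add: cz_Fract[OF r(2) xV] r(1))
    then show ?thesis
      using U[THEN conjunct2, rule_format, OF r(2) cz_closed[OF xV]] by simp
  qed
  then show "R_sub V U" using U by (simp add: R_sub_def)
qed

end

section \<open>Homomorphisms\<close>

definition sl2_hom :: "'a sl2mod \<Rightarrow> 'b sl2mod \<Rightarrow> ('a \<Rightarrow> 'b) \<Rightarrow> bool" where
  "sl2_hom V W f \<longleftrightarrow> (\<forall>x\<in>carrier V. f x \<in> carrier W)
     \<and> (\<forall>x\<in>carrier V. \<forall>y\<in>carrier V. f (add V x y) = add W (f x) (f y))
     \<and> (\<forall>c. \<forall>x\<in>carrier V. f (Module.smult V c x) = Module.smult W c (f x))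
     \<and> (\<forall>x\<in>carrier V. f (Lm V x) = Lm W (f x) \<and> f (L0 V x) = L0 W (f x)
                       \<and> f (Lp V x) = Lp W (f x))"

lemma sl2_hom_closed: "sl2_hom V W f \<Longrightarrow> x \<in> carrier V \<Longrightarrow> f x \<in> carrier W"
  by (simp add: sl2_hom_def)

lemma sl2_iso_iff: "sl2_iso V W \<longleftrightarrow> (\<exists>f. sl2_hom V W f \<and> bij_betw f (carrier V) (carrier W))"
  unfolding sl2_iso_def sl2_hom_def by (intro ex_cong1) (auto dest: bij_betwE)

lemma sl2_hom_comp: "sl2_hom V W f \<Longrightarrow> sl2_hom W X g \<Longrightarrow> sl2_hom V X (\<lambda>x. g (f x))"
  by (simp add: sl2_hom_def)

lemma sl2_hom_zero:
  assumes "zmod V" "zmod W" "sl2_hom V W f"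
  shows "f (zero V) = zero W"
proof -
  interpret V: zmod V by fact
  interpret W: zmod W by fact
  have "f (Module.smult V 0 (zero V)) = Module.smult W 0 (f (zero V))"
    using assms(3) V.C.zero_closed unfolding sl2_hom_def by blast
  then show ?thesis using sl2_hom_closed[OF assms(3) V.C.zero_closed] by simp
qed

lemma sl2_hom_polyact:
  assumes "zmod V" "zmod W" "sl2_hom V W f" "x \<in> carrier V"
  shows "f (polyact V p x) = polyact W p (f x)"
proof -
  interpret V: zmod V by fact
  interpret W: zmod W by fact
  show ?thesis
    by (induction p) (use assms(3,4) in
      \<open>auto simp: sl2_hom_zero[OF assms(1,2,3)] V.polyact_pCons W.polyact_pCons sl2_hom_def\<close>)
qed

lemma submod_vimage:
  assumes V: "sl2 V" and W: "sl2 W" and f: "sl2_hom V W f" and N: "sl2_submod W N"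
  shows "sl2_submod V {x \<in> carrier V. f x \<in> N}"
proof -
  interpret V: sl2 V by fact
  interpret W: sl2 W by fact
  have "f (zero V) = zero W" using V.zmod_axioms W.zmod_axioms f by (rule sl2_hom_zero)
  then show ?thesis using f W.submodD[OF N] by (auto simp: sl2_submod_def[of V] sl2_hom_def)
qed

lemma submod_image:
  assumes V: "sl2 V" and W: "sl2 W" and f: "sl2_hom V W f"
  shows "sl2_submod W (f ` carrier V)"
  unfolding sl2_submod_def
proof (intro conjI allI ballI)
  interpret V: sl2 V by fact
  interpret W: sl2 W by fact
  have "f (zero V) = zero W" using V.zmod_axioms W.zmod_axioms f by (rule sl2_hom_zero)
  then show "zero W \<in> f ` carrier V" by (metis V.C.zero_closed imageI)
  show "f ` carrier V \<subseteq> carrier W" using f by (auto simp: sl2_hom_def)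
  fix x c assume "x \<in> f ` carrier V"
  then obtain x' where x: "x' \<in> carrier V" "x = f x'" by blast
  show "Module.smult W c x \<in> f ` carrier V"
    using f x by (intro image_eqI[of _ _ "Module.smult V c x'"]) (auto simp: sl2_hom_def)
  show "Lm W x \<in> f ` carrier V"
    using f x by (intro image_eqI[of _ _ "Lm V x'"]) (auto simp: sl2_hom_def)
  show "L0 W x \<in> f ` carrier V"
    using f x by (intro image_eqI[of _ _ "L0 V x'"]) (auto simp: sl2_hom_def)
  show "Lp W x \<in> f ` carrier V"
    using f x by (intro image_eqI[of _ _ "Lp V x'"]) (auto simp: sl2_hom_def)
  fix y assume "y \<in> f ` carrier V"
  then obtain y' where y: "y' \<in> carrier V" "y = f y'" by blast
  show "add W x y \<in> f ` carrier V"
    using f x y by (intro image_eqI[of _ _ "add V x' y'"]) (auto simp: sl2_hom_def)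
qed

text \<open>The isomorphism is g^-1 after f.\<close>

lemma sl2_isoI:
  assumes V: "sl2 V" and W: "sl2 W" and M: "sl2 M" and f: "sl2_hom V M f" "inj_on f (carrier V)"
    and g: "sl2_hom W M g" "inj_on g (carrier W)" and im: "f ` carrier V = g ` carrier W"
  shows "sl2_iso V W"
proof -
  interpret V: sl2 V by fact
  interpret W: sl2 W by fact
  define h where "h x = the_inv_into (carrier W) g (f x)" for x
  have h: "h x \<in> carrier W" "g (h x) = f x" if "x \<in> carrier V" for x
  proof -
    have "f x \<in> g ` carrier W" using that im by blast
    then show "h x \<in> carrier W" "g (h x) = f x"
      unfolding h_def using g(2) by (auto intro: the_inv_into_into f_the_inv_into_f)
  qed
  have heq: "h x = y" if "x \<in> carrier V" "y \<in> carrier W" "g y = f x" for x y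
    using that h[of x] by (rule_tac inj_onD[OF g(2)]) auto
  have "sl2_hom V W h"
    unfolding sl2_hom_def
    by (intro conjI ballI allI heq) (use f(1) g(1) h in \<open>auto simp: sl2_hom_def\<close>)
  moreover have "bij_betw h (carrier V) (carrier W)"
  proof (rule bij_betw_imageI)
    show "inj_on h (carrier V)"
    proof (rule inj_onI)
      fix x y assume "x \<in> carrier V" "y \<in> carrier V" "h x = h y"
      then show "x = y" using h(2)[of x] h(2)[of y] f(2) by (auto dest: inj_onD)
    qed
    have "y \<in> h ` carrier V" if y: "y \<in> carrier W" for y
    proof -
      have "g y \<in> f ` carrier V" using y im by blast
      then obtain x where "x \<in> carrier V" "g y = f x" by blast
      then show ?thesis using heq[of x y] y by blast
    qed
    then show "h ` carrier V = carrier W" using h by auto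
  qed
  ultimately show ?thesis by (auto simp: sl2_iso_iff)
qed

section \<open>The rationalization of a torsion free module\<close>

context tfsl2
begin

abbreviation fr where "fr \<equiv> frac_cls V"
abbreviation F where "F \<equiv> Frat V"

text \<open>Transitivity rests on torsion freeness, which cancels the middle denominator q.\<close>

lemma equiv_locrel: "equiv (carrier V \<times> {p. p \<noteq> 0}) (locrel V)"
proof (rule equivI)
  show "locrel V \<subseteq> (carrier V \<times> {p. p \<noteq> 0}) \<times> (carrier V \<times> {p. p \<noteq> 0})"
    by (auto simp: locrel_def)
  show "refl_on (carrier V \<times> {p. p \<noteq> 0}) (locrel V)"
    by (auto simp: locrel_def refl_on_def)
  show "sym (locrel V)" by (auto simp: locrel_def sym_def)
  show "trans (locrel V)"
  proof (rule transI, clarsimp simp: locrel_def)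
    fix v p w q u r
    assume *: "v \<in> carrier V" "w \<in> carrier V" "u \<in> carrier V" "q \<noteq> 0"
      "q \<cdot> v = p \<cdot> w" "r \<cdot> w = q \<cdot> u"
    have "q \<cdot> r \<cdot> v = r \<cdot> p \<cdot> w" using * P.act_commute by metis
    also have "\<dots> = q \<cdot> p \<cdot> u" using * P.act_commute by metis
    finally show "r \<cdot> v = p \<cdot> u" using * polyact_cancel by blast
  qed
qed

lemma fr_eq_iff: "v \<in> carrier V \<Longrightarrow> w \<in> carrier V \<Longrightarrow> p \<noteq> 0 \<Longrightarrow> q \<noteq> 0 \<Longrightarrow>
    fr v p = fr w q \<longleftrightarrow> q \<cdot> v = p \<cdot> w"
  unfolding frac_cls_def using eq_equiv_class_iff[OF equiv_locrel, of "(v, p)" "(w, q)"]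
  by (auto simp: locrel_def)

lemma fr_closed [simp, intro]: "v \<in> carrier V \<Longrightarrow> p \<noteq> 0 \<Longrightarrow> fr v p \<in> carrier F"
  by (auto simp: Frat_def frac_cls_def intro: quotientI)

lemma fr_cases:
  assumes "X \<in> carrier F" obtains v p where "v \<in> carrier V" "p \<noteq> 0" "X = fr v p"
  using assms by (auto simp: Frat_def frac_cls_def elim!: quotientE)

text \<open>The operations of \<open>Frat\<close> are computed on a representative picked by
  \<open>SOME\<close>; its relation to (v, p) makes the result independent of the choice.\<close>

lemma fr_rep:
  assumes "v \<in> carrier V" "p \<noteq> 0"
  obtains w q where "frac_rep (fr v p) = (w, q)" "w \<in> carrier V" "q \<noteq> 0" "q \<cdot> v = p \<cdot> w"
proof -
  have "(v, p) \<in> fr v p"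
    unfolding frac_cls_def using assms by (intro equiv_class_self[OF equiv_locrel]) auto
  then have "frac_rep (fr v p) \<in> fr v p" unfolding frac_rep_def by (rule someI)
  then show ?thesis using that by (auto simp: frac_cls_def locrel_def)
qed

lemma fr_expand: "v \<in> carrier V \<Longrightarrow> p \<noteq> 0 \<Longrightarrow> q \<noteq> 0 \<Longrightarrow> fr (q \<cdot> v) (q * p) = fr v p"
  by (auto simp: fr_eq_iff P.act_mult[symmetric] mult.commute)

lemma fr_zero: "p \<noteq> 0 \<Longrightarrow> zero F = fr \<zero> p"
  by (simp add: Frat_def fr_eq_iff)

lemma fr_eq_zero: "v \<in> carrier V \<Longrightarrow> p \<noteq> 0 \<Longrightarrow> fr v p = zero F \<longleftrightarrow> v = \<zero>"
  by (auto simp: fr_zero[of 1] fr_eq_iff)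

lemma fr_add:
  assumes "v \<in> carrier V" "w \<in> carrier V" "p \<noteq> 0"
  shows "add F (fr v p) (fr w p) = fr (v \<oplus> w) p"
proof -
  obtain v' p' where v': "frac_rep (fr v p) = (v', p')" "v' \<in> carrier V" "p' \<noteq> 0" "p' \<cdot> v = p \<cdot> v'"
    using assms(1,3) by (rule fr_rep)
  obtain w' q' where w': "frac_rep (fr w p) = (w', q')" "w' \<in> carrier V" "q' \<noteq> 0" "q' \<cdot> w = p \<cdot> w'"
    using assms(2,3) by (rule fr_rep)
  have "p \<cdot> (q' \<cdot> v' \<oplus> p' \<cdot> w') = q' \<cdot> p \<cdot> v' \<oplus> p' \<cdot> p \<cdot> w'"
    using v' w' P.act_commute by (simp add: P.act_add_right)
  also have "\<dots> = (p' * q') \<cdot> (v \<oplus> w)"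
    using assms v'(2) w'(2) P.act_commute[of v p' q']
    by (simp add: v'(4)[symmetric] w'(4)[symmetric] P.act_add_right P.act_mult)
  finally show ?thesis using assms v' w' by (simp add: Frat_def fr_eq_iff)
qed

lemma fr_smult: "v \<in> carrier V \<Longrightarrow> p \<noteq> 0 \<Longrightarrow> Module.smult F c (fr v p) = fr (c \<odot> v) p"
  by (rule fr_rep[of v p]) (auto simp: Frat_def fr_eq_iff polyact_smult_commute)

lemma fr_L0: "v \<in> carrier V \<Longrightarrow> p \<noteq> 0 \<Longrightarrow> L0 F (fr v p) = fr (L0 V v) p"
  by (rule fr_rep[of v p]) (auto simp: Frat_def fr_eq_iff polyact_linear[OF lin_L0, symmetric])

lemma fr_Lm: "v \<in> carrier V \<Longrightarrow> p \<noteq> 0 \<Longrightarrow> Lm F (fr v p) = fr (Lm V v) (p \<circ>\<^sub>p [:-1, 1:])"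
  by (rule fr_rep[of v p]) (auto simp: Frat_def fr_eq_iff semilin_polyact[OF semilin_Lm, symmetric])

lemma fr_Lp: "v \<in> carrier V \<Longrightarrow> p \<noteq> 0 \<Longrightarrow> Lp F (fr v p) = fr (Lp V v) (p \<circ>\<^sub>p [:1, 1:])"
  by (rule fr_rep[of v p]) (auto simp: Frat_def fr_eq_iff semilin_polyact[OF semilin_Lp, symmetric])

text \<open>With a common denominator the module laws reduce to those of the numerators.\<close>

lemma fr_cases2:
  assumes "X \<in> carrier F" "Y \<in> carrier F"
  obtains v w p where "v \<in> carrier V" "w \<in> carrier V" "p \<noteq> 0" "X = fr v p" "Y = fr w p"
proof -
  obtain v p where v: "v \<in> carrier V" "p \<noteq> 0" "X = fr v p" using assms(1) by (rule fr_cases)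
  obtain w q where w: "w \<in> carrier V" "q \<noteq> 0" "Y = fr w q" using assms(2) by (rule fr_cases)
  show ?thesis
    using that[of "q \<cdot> v" "p \<cdot> w" "p * q"] v w fr_expand[of v p q] fr_expand[of w q p]
    by (simp add: mult.commute)
qed

lemma fr_cases3:
  assumes "X \<in> carrier F" "Y \<in> carrier F" "Z \<in> carrier F"
  obtains u v w p where "u \<in> carrier V" "v \<in> carrier V" "w \<in> carrier V" "p \<noteq> 0"
    "X = fr u p" "Y = fr v p" "Z = fr w p"
proof -
  obtain u v p where v: "u \<in> carrier V" "v \<in> carrier V" "p \<noteq> 0" "X = fr u p" "Y = fr v p"
    using assms(1,2) by (rule fr_cases2)
  obtain w q where w: "w \<in> carrier V" "q \<noteq> 0" "Z = fr w q" using assms(3) by (rule fr_cases)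
  show ?thesis
    using that[of "q \<cdot> u" "q \<cdot> v" "p \<cdot> w" "p * q"] v w fr_expand[of v p q] fr_expand[of u p q]
      fr_expand[of w q p] by (simp add: mult.commute)
qed

lemma abelian_group_F: "abelian_group F"
proof (rule abelian_groupI)
  show "\<zero>\<^bsub>F\<^esub> \<in> carrier F" by (simp add: fr_zero[of 1])
next
  fix X Y assume "X \<in> carrier F" "Y \<in> carrier F"
  then obtain v w p where "v \<in> carrier V" "w \<in> carrier V" "p \<noteq> 0" "X = fr v p" "Y = fr w p"
    by (rule fr_cases2)
  then show "X \<oplus>\<^bsub>F\<^esub> Y \<in> carrier F" "X \<oplus>\<^bsub>F\<^esub> Y = Y \<oplus>\<^bsub>F\<^esub> X"
    by (auto simp: fr_add C.a_comm)
next
  fix X Y Z assume "X \<in> carrier F" "Y \<in> carrier F" "Z \<in> carrier F"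
  then obtain u v w p where "u \<in> carrier V" "v \<in> carrier V" "w \<in> carrier V" "p \<noteq> 0"
    "X = fr u p" "Y = fr v p" "Z = fr w p" by (rule fr_cases3)
  then show "X \<oplus>\<^bsub>F\<^esub> Y \<oplus>\<^bsub>F\<^esub> Z = X \<oplus>\<^bsub>F\<^esub> (Y \<oplus>\<^bsub>F\<^esub> Z)"
    by (simp add: fr_add C.a_assoc)
next
  fix X assume "X \<in> carrier F"
  then obtain v p where v: "v \<in> carrier V" "p \<noteq> 0" "X = fr v p" by (rule fr_cases)
  then show "\<zero>\<^bsub>F\<^esub> \<oplus>\<^bsub>F\<^esub> X = X" by (simp add: fr_zero[of p] fr_add)
  show "\<exists>Y\<in>carrier F. Y \<oplus>\<^bsub>F\<^esub> X = \<zero>\<^bsub>F\<^esub>"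
    using v by (intro bexI[of _ "fr (\<ominus> v) p"]) (auto simp: fr_zero[of p] fr_add C.l_neg)
qed

lemma kmod_F: "kmod F (Module.smult F)"
proof (intro kmod.intro kmod_axioms.intro abelian_group_F)
  fix X c d assume "X \<in> carrier F"
  then obtain v p where v: "v \<in> carrier V" "p \<noteq> 0" "X = fr v p" by (rule fr_cases)
  then show "c \<odot>\<^bsub>F\<^esub> X \<in> carrier F" "(c + d) \<odot>\<^bsub>F\<^esub> X = c \<odot>\<^bsub>F\<^esub> X \<oplus>\<^bsub>F\<^esub> d \<odot>\<^bsub>F\<^esub> X"
    "(c * d) \<odot>\<^bsub>F\<^esub> X = c \<odot>\<^bsub>F\<^esub> (d \<odot>\<^bsub>F\<^esub> X)" "1 \<odot>\<^bsub>F\<^esub> X = X"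
    by (auto simp: fr_smult fr_add C.act_add_left C.act_mult)
next
  fix X Y c assume "X \<in> carrier F" "Y \<in> carrier F"
  then obtain v w p where "v \<in> carrier V" "w \<in> carrier V" "p \<noteq> 0" "X = fr v p" "Y = fr w p"
    by (rule fr_cases2)
  then show "c \<odot>\<^bsub>F\<^esub> (X \<oplus>\<^bsub>F\<^esub> Y) = c \<odot>\<^bsub>F\<^esub> X \<oplus>\<^bsub>F\<^esub> c \<odot>\<^bsub>F\<^esub> Y"
    by (simp add: fr_smult fr_add C.act_add_right)
qed

text \<open>In each bracket relation the shifts of the denominator have the same total in all terms,
  so the relations of V carry over to the numerators.\<close>

lemma is_sl2_F: "is_sl2mod F"
proof -
  have lin: "lin_endo F T" if *: "\<And>v p. v \<in> carrier V \<Longrightarrow> p \<noteq> 0 \<Longrightarrow> T (fr v p) = fr (S v) (p \<circ>\<^sub>p [:a, 1:])"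
    and S: "lin_endo V S" for T S a
    unfolding lin_endo_def
  proof (intro conjI ballI allI)
    fix X c assume X: "X \<in> carrier F"
    then obtain v p where "v \<in> carrier V" "p \<noteq> 0" "X = fr v p" by (rule fr_cases)
    then show "T X \<in> carrier F" "T (c \<odot>\<^bsub>F\<^esub> X) = c \<odot>\<^bsub>F\<^esub> T X"
      using S by (auto simp: * fr_smult lin_endoD[OF S])
    fix Y assume "Y \<in> carrier F"
    with X obtain v w p where "v \<in> carrier V" "w \<in> carrier V" "p \<noteq> 0" "X = fr v p" "Y = fr w p"
      by (rule fr_cases2)
    then show "T (X \<oplus>\<^bsub>F\<^esub> Y) = T X \<oplus>\<^bsub>F\<^esub> T Y"
      using S by (simp add: * fr_add lin_endoD[OF S])
  qed
  have "lin_endo F (L0 F)" using fr_L0 lin_L0 by (intro lin[where a = 0]) auto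
  moreover have "lin_endo F (Lm F)" using fr_Lm lin_Lm by (intro lin) auto
  moreover have "lin_endo F (Lp F)" using fr_Lp lin_Lp by (intro lin) auto
  moreover have "comm_eq F (L0 F) (Lm F) 1 (Lm F)" "comm_eq F (Lp F) (L0 F) 1 (Lp F)"
    "comm_eq F (Lp F) (Lm F) 2 (L0 F)"
    unfolding comm_eq_def
    by (rule ballI, erule fr_cases, simp add: fr_L0 fr_Lm fr_Lp fr_smult fr_add
      pcompose_shift_shift sl2_relations minus_eq_smult[symmetric] ab_simps)+
  ultimately show ?thesis using module_CC_of_kmod[OF kmod_F] by (simp add: is_sl2mod_def)
qed

interpretation F: sl2 F by unfold_locales (rule is_sl2_F)

lemma fr_polyact: "v \<in> carrier V \<Longrightarrow> p \<noteq> 0 \<Longrightarrow> polyact F s (fr v p) = fr (s \<cdot> v) p"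
  by (induction s) (auto simp: F.polyact_pCons polyact_pCons fr_zero fr_smult fr_L0 fr_add)

lemma ratsl2_F: "ratsl2 F"
proof -
  have "bij_betw (polyact F s) (carrier F) (carrier F)" if s: "s \<noteq> 0" for s
  proof (rule bij_betw_imageI)
    show "inj_on (polyact F s) (carrier F)"
    proof (rule inj_onI)
      fix X Y assume XY: "X \<in> carrier F" "Y \<in> carrier F" "polyact F s X = polyact F s Y"
      obtain v w p where *: "v \<in> carrier V" "w \<in> carrier V" "p \<noteq> 0" "X = fr v p" "Y = fr w p"
        using XY(1,2) by (rule fr_cases2)
      then have "(p * s) \<cdot> v = (p * s) \<cdot> w" using XY by (simp add: fr_polyact fr_eq_iff P.act_mult)
      then have "v = w" using * s polyact_cancel[of v w "p * s"] by simp
      then show "X = Y" using * by simp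
    qed
    have "X \<in> polyact F s ` carrier F" if "X \<in> carrier F" for X
    proof -
      obtain v p where v: "v \<in> carrier V" "p \<noteq> 0" "X = fr v p" using \<open>X \<in> carrier F\<close> by (rule fr_cases)
      then have "X = polyact F s (fr v (s * p))" using s by (simp add: fr_polyact fr_expand)
      then show ?thesis using v s by (intro image_eqI[of _ _ "fr v (s * p)"]) auto
    qed
    then show "polyact F s ` carrier F = carrier F" by auto
  qed
  then show ?thesis by unfold_locales
qed

lemma bounded_rank_F:
  assumes bounded_rank shows "F.bounded_rank"
proof -
  obtain bs where bs: "set bs \<subseteq> carrier V"
    "\<And>x. x \<in> carrier V \<Longrightarrow> \<exists>s ps. s \<noteq> 0 \<and> length ps = length bs \<and> s \<cdot> x = P.lincomb ps bs"
    using assms unfolding bounded_rank_def by blast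
  define cs where "cs = map (\<lambda>b. fr b 1) bs"
  have "\<exists>s ps. s \<noteq> 0 \<and> length ps = length cs \<and> polyact F s X = F.P.lincomb ps cs"
    if "X \<in> carrier F" for X
  proof -
    obtain v p where v: "v \<in> carrier V" "p \<noteq> 0" "X = fr v p" using \<open>X \<in> carrier F\<close> by (rule fr_cases)
    obtain s ps where s: "s \<noteq> 0" "length ps = length bs" "s \<cdot> v = P.lincomb ps bs" using bs v by blast
    have "polyact F (p * s) X = fr (s \<cdot> v) 1"
    proof -
      have "fr (p \<cdot> s \<cdot> v) p = fr (s \<cdot> v) 1" using v by (subst fr_eq_iff) auto
      then show ?thesis using v by (simp add: fr_polyact P.act_mult)
    qed
    also have "\<dots> = F.P.lincomb ps cs"
      unfolding s(3) cs_def using s(2) bs(1)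
      by (induction ps bs rule: list_induct2) (auto simp: fr_zero[of 1] fr_polyact fr_add[symmetric])
    finally show ?thesis using s v
      by (intro exI[of _ "p * s"] exI[of _ ps]) (auto simp: cs_def)
  qed
  moreover have "set cs \<subseteq> carrier F" using bs(1) by (auto simp: cs_def)
  ultimately show ?thesis unfolding F.bounded_rank_def by blast
qed

lemma sl2_hom_fr: "sl2_hom V F (\<lambda>v. fr v 1)"
  by (simp add: sl2_hom_def fr_add fr_smult fr_L0 fr_Lm fr_Lp pcompose_1)

lemma inj_fr: "inj_on (\<lambda>v. fr v 1) (carrier V)"
  by (auto intro!: inj_onI simp: fr_eq_iff)

lemma fr_clear: "v \<in> carrier V \<Longrightarrow> p \<noteq> 0 \<Longrightarrow> polyact F p (fr v p) = fr v 1"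
  by (simp add: fr_polyact fr_eq_iff)

lemma R_simple_F:
  assumes S: "simple V" and br: "bounded_rank"
  shows "R_simple F"
proof -
  interpret F: ratsl2 F by (rule ratsl2_F)
  obtain v where v: "v \<in> carrier V" "v \<noteq> \<zero>"
    using S C.zero_closed unfolding simple_def by blast
  have "U = {\<zero>\<^bsub>F\<^esub>} \<or> U = carrier F" if U: "R_sub F U" for U
  proof -
    note * = U[unfolded F.R_sub_iff, THEN conjunct1] U[unfolded F.R_sub_iff, THEN conjunct2, rule_format]
    \<comment> \<open>Clearing and restoring denominators shows that v/p lies in \<open>U\<close>
      iff v/1 does, so \<open>U\<close> is determined by \<open>N\<close>.\<close>
    define N where "N = {v \<in> carrier V. fr v 1 \<in> U}"
    have "sl2_submod V N"
      unfolding N_def using sl2_axioms F.sl2_axioms sl2_hom_fr *(1) by (rule submod_vimage)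
    then consider "N = {\<zero>}" | "N = carrier V" using S unfolding simple_def by blast
    then show ?thesis
    proof cases
      case 1
      have "X = \<zero>\<^bsub>F\<^esub>" if X: "X \<in> U" for X
      proof -
        obtain v p where v: "v \<in> carrier V" "p \<noteq> 0" "X = fr v p"
          using F.submodD(1)[OF *(1) X] by (rule fr_cases)
        then have "fr v 1 \<in> U" using F.submod_polyact[OF *(1) X, of p] by (simp add: fr_clear)
        then have "v = \<zero>" using v 1 by (auto simp: N_def)
        then show ?thesis using v by (simp add: fr_eq_zero)
      qed
      then show ?thesis using F.submodD(2)[OF *(1)] by blast
    next
      case 2
      have "X \<in> U" if X: "X \<in> carrier F" for X
      proof -
        obtain v p where v: "v \<in> carrier V" "p \<noteq> 0" "X = fr v p" using X by (rule fr_cases)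
        then have "fr v 1 \<in> U" using 2 by (auto simp: N_def)
        then show ?thesis using *(2)[of p X] v X by (simp add: fr_clear)
      qed
      then show ?thesis using F.submodD(1)[OF *(1)] by blast
    qed
  qed
  moreover have "carrier F \<noteq> {\<zero>\<^bsub>F\<^esub>}"
    using v fr_closed[of v 1] fr_eq_zero[of v 1] by auto
  moreover have "rational F" using ratsl2_F bounded_rank_F[OF br] by (simp add: rational_iff)
  ultimately show ?thesis by (simp add: R_simple_def)
qed

text \<open>The isomorphism sends v/p to the unique y with p y = f v; the density hypothesis makes
  it onto.\<close>

lemma Frat_universal:
  assumes W: "ratsl2 W" and f: "sl2_hom V W f" "inj_on f (carrier V)"
    and dense: "\<And>y. y \<in> carrier W \<Longrightarrow> \<exists>s x. s \<noteq> 0 \<and> x \<in> carrier V \<and> polyact W s y = f x"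
  shows "sl2_iso F W"
proof -
  interpret W: ratsl2 W by fact
  note fpoly = sl2_hom_polyact[OF zmod_axioms W.zmod_axioms f(1)]
  note fhom = f(1)[unfolded sl2_hom_def, THEN conjunct1, rule_format]
    f(1)[unfolded sl2_hom_def, THEN conjunct2, THEN conjunct1, rule_format]
    f(1)[unfolded sl2_hom_def, THEN conjunct2, THEN conjunct2, THEN conjunct1, rule_format]
    f(1)[unfolded sl2_hom_def, THEN conjunct2, THEN conjunct2, THEN conjunct2, rule_format]
  \<comment> \<open>The description ranges over all representatives of \<open>X\<close>; two
    candidates agree after multiplication by the product of the denominators.\<close>
  define g where "g X = (THE y. y \<in> carrier W \<and>
    (\<exists>v p. v \<in> carrier V \<and> p \<noteq> 0 \<and> X = fr v p \<and> polyact W p y = f v))" for X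
  have g: "g (fr v p) = y" if "v \<in> carrier V" "p \<noteq> 0" "y \<in> carrier W" "polyact W p y = f v" for v p y
    unfolding g_def
  proof (rule the_equality)
    show "y \<in> carrier W \<and> (\<exists>v' p'. v' \<in> carrier V \<and> p' \<noteq> 0 \<and> fr v p = fr v' p' \<and> polyact W p' y = f v')"
      using that by blast
    fix y' assume "y' \<in> carrier W \<and> (\<exists>v' p'. v' \<in> carrier V \<and> p' \<noteq> 0 \<and> fr v p = fr v' p' \<and> polyact W p' y' = f v')"
    then obtain w q where **: "y' \<in> carrier W" "w \<in> carrier V" "q \<noteq> 0" "fr v p = fr w q" "polyact W q y' = f w"
      by blast
    then have *: "y' \<in> carrier W" "w \<in> carrier V" "q \<noteq> 0" "q \<cdot> v = p \<cdot> w" "polyact W q y' = f w"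
      using that by (auto simp: fr_eq_iff)
    have "polyact W (p * q) y' = f (p \<cdot> w)" using * that by (simp add: W.P.act_mult fpoly)
    also have "\<dots> = polyact W q (polyact W p y)" using * that by (simp add: fpoly flip: *(4))
    also have "\<dots> = polyact W (p * q) y" using that W.P.act_mult[of y q p] by (simp add: mult.commute)
    finally show "y' = y" using * that W.polyact_cancel[of y' y "p * q"] by simp
  qed
  have g_ex: "\<exists>y. y \<in> carrier W \<and> polyact W p y = f v \<and> g (fr v p) = y"
    if v: "v \<in> carrier V" and p: "p \<noteq> 0" for v p
  proof -
    obtain y where "y \<in> carrier W" "polyact W p y = f v"
      using W.rat_divide[OF p fhom(1)[OF v]] .
    then show ?thesis using g[OF v p] by (intro exI[of _ y]) simp
  qed
  have "sl2_hom F W g"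
    unfolding sl2_hom_def
  proof (intro conjI ballI allI)
    fix X c assume X: "X \<in> carrier F"
    then obtain v p where v: "v \<in> carrier V" "p \<noteq> 0" "X = fr v p" by (rule fr_cases)
    obtain y where y: "y \<in> carrier W" "polyact W p y = f v" "g X = y"
      using g_ex[OF v(1,2)] v(3) by auto
    show "g X \<in> carrier W" using y by simp
    show "g (c \<odot>\<^bsub>F\<^esub> X) = c \<odot>\<^bsub>W\<^esub> g X"
      using v y by (simp add: fr_smult g fhom W.polyact_smult_commute)
    show "g (L0 F X) = L0 W (g X)"
      using v y by (simp add: fr_L0 g fhom W.polyact_linear[OF W.lin_L0, symmetric])
    show "g (Lm F X) = Lm W (g X)"
      using v y by (simp add: fr_Lm g fhom W.semilin_polyact[OF W.semilin_Lm, symmetric])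
    show "g (Lp F X) = Lp W (g X)"
      using v y by (simp add: fr_Lp g fhom W.semilin_polyact[OF W.semilin_Lp, symmetric])
  next
    fix X Y assume XY: "X \<in> carrier F" "Y \<in> carrier F"
    then obtain v w p where v: "v \<in> carrier V" "w \<in> carrier V" "p \<noteq> 0" "X = fr v p" "Y = fr w p"
      by (rule fr_cases2)
    obtain y where y: "y \<in> carrier W" "polyact W p y = f v" "g X = y" using g_ex[OF v(1,3)] v(4) by auto
    obtain z where z: "z \<in> carrier W" "polyact W p z = f w" "g Y = z" using g_ex[OF v(2,3)] v(5) by auto
    show "g (X \<oplus>\<^bsub>F\<^esub> Y) = g X \<oplus>\<^bsub>W\<^esub> g Y"
      unfolding y z unfolding v(4,5) using v(1-3) y z
      by (simp add: fr_add g fhom W.P.act_add_right)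
  qed
  moreover have "bij_betw g (carrier F) (carrier W)"
  proof (rule bij_betw_imageI)
    show "inj_on g (carrier F)"
    proof (rule inj_onI)
      fix X Y assume XY: "X \<in> carrier F" "Y \<in> carrier F" "g X = g Y"
      from XY(1,2) obtain v w p where v: "v \<in> carrier V" "w \<in> carrier V" "p \<noteq> 0" "X = fr v p" "Y = fr w p"
        by (rule fr_cases2)
      obtain y where y: "polyact W p y = f v" "g X = y" using g_ex[OF v(1,3)] v(4) by auto
      obtain z where z: "polyact W p z = f w" "g Y = z" using g_ex[OF v(2,3)] v(5) by auto
      have "f v = f w" using y z XY(3) by simp
      then show "X = Y" using v by (auto dest: inj_onD[OF f(2)])
    qed
    have "y \<in> g ` carrier F" if "y \<in> carrier W" for y
    proof -
      obtain s x where "s \<noteq> 0" "x \<in> carrier V" "polyact W s y = f x" using dense[OF \<open>y \<in> carrier W\<close>] by blast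
      then show ?thesis using g[of x s y] that by (intro image_eqI[of _ _ "fr x s"]) auto
    qed
    moreover have "g X \<in> carrier W" if "X \<in> carrier F" for X
    proof -
      obtain v p where v: "v \<in> carrier V" "p \<noteq> 0" "X = fr v p" using \<open>X \<in> carrier F\<close> by (rule fr_cases)
      then show ?thesis using g_ex[OF v(1,2)] by auto
    qed
    ultimately show "g ` carrier F = carrier W" by auto
  qed
  ultimately show ?thesis by (auto simp: sl2_iso_iff)
qed

end

subsection \<open>Simple submodules of rational modules\<close>

text \<open>A common root makes k a one of the finitely many differences of roots of p and
  q.\<close>

lemma eventually_no_common_root:
  fixes p q :: "complex poly"
  assumes "p \<noteq> 0" "q \<noteq> 0" "a \<noteq> 0"
  shows "\<exists>K. \<forall>k\<ge>K. \<forall>x. \<not> (poly p (of_nat k * a + x) = 0 \<and> poly q x = 0)"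
proof -
  define D where "D = (\<lambda>(y, x). y - x) ` ({y. poly p y = 0} \<times> {x. poly q x = 0})"
  have "finite D" unfolding D_def using assms by (intro finite_imageI finite_cartesian_product poly_roots_finite)
  then have "finite ((\<lambda>k. of_nat k * a) -` D)"
    using assms(3) by (intro finite_vimageI) (auto intro: injI)
  then obtain K where K: "\<forall>k\<in>(\<lambda>k. of_nat k * a) -` D. k < K"
    using finite_nat_set_iff_bounded by blast
  have "\<not> (poly p (of_nat k * a + x) = 0 \<and> poly q x = 0)" if "k \<ge> K" for k x
  proof
    assume "poly p (of_nat k * a + x) = 0 \<and> poly q x = 0"
    then have "of_nat k * a \<in> D" unfolding D_def
      by (intro image_eqI[of _ _ "(of_nat k * a + x, x)"]) auto
    then have "k < K" using K by blast
    then show False using that by simp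
  qed
  then show ?thesis by blast
qed

lemma coprime_if_no_common_root:
  fixes p q :: "complex poly"
  assumes "\<And>x. \<not> (poly p x = 0 \<and> poly q x = 0)"
  shows "coprime p q"
proof (rule coprimeI)
  fix c assume c: "c dvd p" "c dvd q"
  have "constant (poly c)"
  proof (rule ccontr)
    assume "\<not> constant (poly c)"
    then obtain x where "poly c x = 0" using fundamental_theorem_of_algebra by blast
    then have "poly p x = 0" "poly q x = 0" using c by (auto elim!: dvdE)
    then show False using assms by blast
  qed
  moreover have "c \<noteq> 0" using c assms[of 0] by auto
  ultimately show "is_unit c" by (simp add: constant_degree is_unit_iff_degree)
qed

context zmod
begin

lemma pow_pact:
  assumes T: "semilin a T" and x: "x \<in> carrier V"
  shows "(T ^^ n) (pact T R x) =
    pact T (map_poly (\<lambda>r. r \<circ>\<^sub>p [:of_nat n * a, 1:]) R) ((T ^^ n) x)"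
proof (induction n)
  case (Suc n)
  have "(T ^^ Suc n) (pact T R x) = pact T (map_poly (\<lambda>r. r \<circ>\<^sub>p [:a, 1:])
      (map_poly (\<lambda>r. r \<circ>\<^sub>p [:of_nat n * a, 1:]) R)) ((T ^^ Suc n) x)"
    using x by (simp add: Suc pact_semilin[OF T] pow_closed[OF T])
  also have "map_poly (\<lambda>r. r \<circ>\<^sub>p [:a, 1:]) (map_poly (\<lambda>r. r \<circ>\<^sub>p [:of_nat n * a, 1:]) R) =
      map_poly (\<lambda>r. r \<circ>\<^sub>p [:of_nat (Suc n) * a, 1:]) R"
    by (subst map_poly_map_poly) (auto simp: o_def pcompose_shift_shift algebra_simps)
  finally show ?case .
qed (simp add: map_poly_idI)

end

section \<open>Denominators of a vector with respect to submodules\<close>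

context sl2
begin

text \<open>The polynomials c with c v in \<open>N\<close> form an ideal; by Bezout, if it contains
  b and h a with h and b coprime, then it contains a.\<close>

lemma submod_coprime:
  assumes N: "sl2_submod V N" and v: "v \<in> carrier V"
    and b: "b \<cdot> v \<in> N" and ha: "(h * a) \<cdot> v \<in> N" and hb: "coprime h b"
  shows "a \<cdot> v \<in> N"
proof -
  obtain u w where uw: "u * h + w * b = 1"
    using bezout_coefficients_fst_snd[of h b] hb by (metis coprime_iff_gcd_eq_1)
  have "a = (u * h + w * b) * a" unfolding uw by simp
  also have "\<dots> = u * (h * a) + (w * a) * b" by (simp add: algebra_simps)
  finally have a: "a = u * (h * a) + (w * a) * b" .
  have "(u * (h * a) + (w * a) * b) \<cdot> v = u \<cdot> (h * a) \<cdot> v \<oplus> (w * a) \<cdot> b \<cdot> v"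
    using v by (simp only: P.act_add_left P.act_mult P.act_closed)
  also have "\<dots> \<in> N" by (intro submodD(3)[OF N] submod_polyact[OF N] ha b)
  finally show ?thesis unfolding a[symmetric] .
qed

lemma submod_pact:
  assumes N: "sl2_submod V N" and T: "semilin a T"
  shows "u \<in> carrier V \<Longrightarrow> (\<And>i. i \<le> degree Q \<Longrightarrow> h \<cdot> (T ^^ i) u \<in> N) \<Longrightarrow> h \<cdot> pact T Q u \<in> N"
proof (induction Q arbitrary: u)
  case 0 then show ?case using submodD(2)[OF N] by simp
next
  case (pCons q Q)
  note [simp] = semilinD(1)[OF T] pact_closed[OF T]
  have "h \<cdot> u \<in> N" using pCons.prems(2)[of 0] by simp
  then have "q \<cdot> h \<cdot> u \<in> N" by (rule submod_polyact[OF N])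
  then have 1: "h \<cdot> q \<cdot> u \<in> N" using P.act_commute[of u h q] pCons.prems(1) by simp
  have 2: "h \<cdot> pact T Q (T u) \<in> N"
  proof (cases "Q = 0")
    case True then show ?thesis using submodD(2)[OF N] by simp
  next
    case False
    have "h \<cdot> (T ^^ i) (T u) \<in> N" if "i \<le> degree Q" for i
      using pCons.prems(2)[of "Suc i"] that False by (simp add: funpow_swap1)
    then show ?thesis using pCons.IH[of "T u"] pCons.prems(1) by simp
  qed
  have "h \<cdot> pact T (pCons q Q) u = h \<cdot> q \<cdot> u \<oplus> h \<cdot> pact T Q (T u)"
    using pCons.prems(1) by (simp add: pact_pCons[OF T] P.act_add_right)
  then show ?case using submodD(3)[OF N 1 2] by simp
qed

text \<open>Solving the relation \<open>R\<close> backwards turns information on \<open>T\<^sup>k v\<close>, \<open>k \<ge> K\<close>, into information on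
  \<open>v\<close>. As \<open>K\<close> grows, the zeros of the shifts of \<open>s\<close> move away from those of \<open>s\<close>, so \<open>s\<close> can be
  replaced by a product that depends on \<open>N\<close> only through its length.\<close>

lemma submod_product:
  assumes N: "sl2_submod V N" and T: "semilin a T" and TN: "\<And>x. x \<in> N \<Longrightarrow> T x \<in> N"
    and a: "a \<noteq> 0" and v: "v \<in> carrier V" and R: "pact T R v = \<zero>"
    and s: "s \<noteq> 0" "s \<cdot> v \<in> N"
  shows "\<exists>K0. \<forall>K\<ge>K0. (\<Prod>k<K. coeff R 0 \<circ>\<^sub>p [:of_nat k * a, 1:]) \<cdot> v \<in> N"
proof -
  note [simp] = semilinD(1)[OF T] pact_closed[OF T] pow_closed[OF T]
  define d where "d = degree R"
  define r where "r k = coeff R 0 \<circ>\<^sub>p [:of_nat k * a, 1:]" for k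
  \<comment> \<open>h carries the window of d + 1 consecutive iterates starting at
    \<open>(T ^^ K) v\<close> into \<open>N\<close>. The relation moves the window down one step at
    the cost of the factor \<open>r K\<close>.\<close>
  define G where "G K h \<longleftrightarrow> (\<forall>i\<le>d. h \<cdot> (T ^^ (K + i)) v \<in> N)" for K h
  have step: "G K (h * r K)" if G: "G (Suc K) h" for K h
    unfolding G_def
  proof (intro allI impI)
    fix i assume i: "i \<le> d"
    show "(h * r K) \<cdot> (T ^^ (K + i)) v \<in> N"
    proof (cases i)
      case (Suc j)
      then have "h \<cdot> (T ^^ (K + i)) v \<in> N" using G i unfolding G_def by (metis add_Suc_shift Suc_leD)
      then have "r K \<cdot> h \<cdot> (T ^^ (K + i)) v \<in> N" by (rule submod_polyact[OF N])
      then show ?thesis using v P.act_mult[of "(T ^^ (K + i)) v" "r K" h] by (simp add: mult.commute)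
    next
      case 0
      obtain q R' where R': "R = pCons q R'" by (cases R)
      have pow_add: "(T ^^ K) (x \<oplus> y) = (T ^^ K) x \<oplus> (T ^^ K) y" if "x \<in> carrier V" "y \<in> carrier V" for x y
        using that by (induction K) (auto simp: semilinD(2)[OF T])
      have pow_zero: "(T ^^ K) \<zero> = \<zero>" by (induction K) (auto simp: semilinD(4)[OF T])
      \<comment> \<open>Applying \<open>T ^^ K\<close> to the relation expresses
        \<open>r K \<cdot> (T ^^ K) v\<close> by the iterates from \<open>Suc K\<close> on.\<close>
      have "\<zero> = (T ^^ K) (pact T R v)" using R pow_zero by simp
      also have "\<dots> = (T ^^ K) (q \<cdot> v) \<oplus> (T ^^ K) (pact T R' (T v))"
        using v by (simp add: R' pact_pCons[OF T] pow_add)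
      also have "(T ^^ K) (q \<cdot> v) = r K \<cdot> (T ^^ K) v"
        using v by (simp add: pow_polyact[OF T] r_def R')
      also have "(T ^^ K) (pact T R' (T v)) =
          pact T (map_poly (\<lambda>r. r \<circ>\<^sub>p [:of_nat K * a, 1:]) R') ((T ^^ Suc K) v)"
        using v by (simp add: pow_pact[OF T] funpow_swap1)
      finally have rel: "r K \<cdot> (T ^^ K) v =
          \<ominus> pact T (map_poly (\<lambda>r. r \<circ>\<^sub>p [:of_nat K * a, 1:]) R') ((T ^^ Suc K) v)"
        using v by (intro C.minus_equality[symmetric]) simp_all
      have "degree (map_poly (\<lambda>r. r \<circ>\<^sub>p [:of_nat K * a, 1:]) R') \<le> d"
        using degree_map_poly_shift_le[of "of_nat K * a" R'] by (auto simp: d_def R')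
      then have "h \<cdot> pact T (map_poly (\<lambda>r. r \<circ>\<^sub>p [:of_nat K * a, 1:]) R') ((T ^^ Suc K) v) \<in> N"
        using G v unfolding G_def
        by (intro submod_pact[OF N T]) (auto simp del: funpow.simps simp: funpow_add[symmetric, THEN fun_cong, simplified o_apply] add.commute)
      then have "h \<cdot> r K \<cdot> (T ^^ K) v \<in> N"
        using v submod_minus[OF N] by (simp add: rel P.act_uminus_right del: funpow.simps)
      then show ?thesis using v 0 by (simp add: P.act_mult)
    qed
  qed
  have down: "G 0 (h * (\<Prod>k<K. r k))" if "G K h" for K h
    using that
  proof (induction K arbitrary: h)
    case (Suc K)
    then show ?case using Suc.IH[of "h * r K"] step[of K h] by (simp add: mult_ac)
  qed simp
  obtain K0 where K0: "\<And>k x. k \<ge> K0 \<Longrightarrow> \<not> (poly s (of_nat k * a + x) = 0 \<and> poly s x = 0)"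
    using eventually_no_common_root[OF s(1) s(1) a] by blast
  have "(\<Prod>k<K. r k) \<cdot> v \<in> N" if K: "K \<ge> K0" for K
  proof -
    \<comment> \<open>Applying \<open>T ^^ (K + i)\<close> to s v in \<open>N\<close> shows that
      \<open>t i\<close> is a denominator of that iterate; the product h serves the whole
      window.\<close>
    define t where "t i = s \<circ>\<^sub>p [:of_nat (K + i) * a, 1:]" for i
    define h where "h = (\<Prod>i\<le>d. t i)"
    have "G K h"
      unfolding G_def
    proof (intro allI impI)
      fix i assume "i \<le> d"
      then obtain h' where h': "h = h' * t i"
        unfolding h_def by (metis atMost_iff dvd_prodI dvdE finite_atMost mult.commute)
      have "(T ^^ n) x \<in> N" if "x \<in> N" for x n using that TN by (induction n) auto
      then have "(T ^^ (K + i)) (s \<cdot> v) \<in> N" using s(2) by blast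
      then have "t i \<cdot> (T ^^ (K + i)) v \<in> N" using v unfolding t_def by (simp only: pow_polyact[OF T])
      then show "h \<cdot> (T ^^ (K + i)) v \<in> N"
        using v submod_polyact[OF N, of _ h'] by (simp add: h' P.act_mult)
    qed
    then have "G 0 (h * (\<Prod>k<K. r k))" by (rule down)
    then have *: "(h * (\<Prod>k<K. r k)) \<cdot> v \<in> N" unfolding G_def by auto
    \<comment> \<open>For K \<ge> \<open>K0\<close> the shifted s has no root in common with s, so h
      is coprime to s and is dropped by \<open>submod_coprime\<close>.\<close>
    have "coprime (t i) s" for i
      using K0[of "K + i"] K
      by (intro coprime_if_no_common_root) (auto simp: t_def poly_pcompose)
    then have "coprime h s" unfolding h_def by (intro prod_coprime_left)
    then show ?thesis using submod_coprime[OF N v s(2) *] by blast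
  qed
  then show ?thesis unfolding r_def by blast
qed

lemma uniform_denominator:
  assumes v: "v \<in> carrier V" and R: "coeff R 0 \<noteq> 0" "pact (Lm V) R v = \<zero>"
    and S: "coeff S 0 \<noteq> 0" "pact (Lp V) S v = \<zero>"
  shows "\<exists>g. g \<noteq> 0 \<and> (\<forall>N s. sl2_submod V N \<longrightarrow> s \<noteq> 0 \<longrightarrow> s \<cdot> v \<in> N \<longrightarrow> g \<cdot> v \<in> N)"
proof -
  define r where "r k = coeff R 0 \<circ>\<^sub>p [:of_nat k * -1, 1:]" for k
  define t where "t k = coeff S 0 \<circ>\<^sub>p [:of_nat k * 1, 1:]" for k
  obtain K1 where K1: "\<And>k x. k \<ge> K1 \<Longrightarrow>
      \<not> (poly (coeff R 0) (of_nat k * -1 + x) = 0 \<and> poly (coeff S 0) x = 0)"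
    using eventually_no_common_root[OF R(1) S(1), of "-1"] by auto
  \<comment> \<open>A common root makes k + l a difference of roots of the two constant
    coefficients, which k \<ge> \<open>K1\<close> excludes for every l.\<close>
  have cop: "coprime (r k) (t l)" if "k \<ge> K1" for k l
  proof (rule coprime_if_no_common_root)
    fix x show "\<not> (poly (r k) x = 0 \<and> poly (t l) x = 0)"
      using K1[of "k + l" "of_nat l + x"] that by (simp add: r_def t_def poly_pcompose algebra_simps)
  qed
  have "(\<Prod>k<K1. r k) \<cdot> v \<in> N" if N: "sl2_submod V N" and s: "s \<noteq> 0" "s \<cdot> v \<in> N" for N s
  proof -
    obtain K where K: "\<And>k. k \<ge> K \<Longrightarrow> (\<Prod>k<k. r k) \<cdot> v \<in> N"
      using submod_product[OF N semilin_Lm submodD(5)[OF N] _ v R(2) s] unfolding r_def by auto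
    obtain L where L: "(\<Prod>k<L. t k) \<cdot> v \<in> N"
      using submod_product[OF N semilin_Lp submodD(7)[OF N] _ v S(2) s] unfolding t_def by auto
    have "(\<Prod>k<K1 + K. r k) = (\<Prod>k\<in>{K1..<K1 + K}. r k) * (\<Prod>k<K1. r k)"
      using prod.atLeastLessThan_concat[of 0 K1 "K1 + K" r] by (simp add: lessThan_atLeast0 mult.commute)
    then have "((\<Prod>k\<in>{K1..<K1 + K}. r k) * (\<Prod>k<K1. r k)) \<cdot> v \<in> N" using K[of "K1 + K"] by simp
    moreover have "coprime (\<Prod>k\<in>{K1..<K1 + K}. r k) (\<Prod>k<L. t k)"
      by (intro prod_coprime_left prod_coprime_right cop) auto
    ultimately show ?thesis using submod_coprime[OF N v L] by blast
  qed
  moreover have "(\<Prod>k<K1. r k) \<noteq> 0" using R(1) by (auto simp: r_def)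
  ultimately show ?thesis by blast
qed

lemma is_sl2mod_submod:
  assumes N: "sl2_submod V N"
  shows "is_sl2mod (V\<lparr>carrier := N\<rparr>)"
proof -
  let ?N = "V\<lparr>carrier := N\<rparr>"
  note [simp] = submodD(2-7)[OF N]
  have NV: "x \<in> carrier V" if "x \<in> N" for x using submodD(1)[OF N that] .
  have "abelian_group ?N"
  proof (rule abelian_groupI)
    fix x assume x: "x \<in> carrier ?N"
    show "\<exists>y\<in>carrier ?N. y \<oplus>\<^bsub>?N\<^esub> x = \<zero>\<^bsub>?N\<^esub>"
      using submod_minus[OF N, of x] NV[of x] x by (intro bexI[of _ "\<ominus> x"]) (auto simp: C.l_neg)
  qed (auto simp: NV C.a_ac)
  then have "kmod ?N (Module.smult ?N)"
    by (intro kmod.intro kmod_axioms.intro)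
      (auto simp: NV C.act_add_left C.act_add_right C.act_mult)
  moreover have "lin_endo ?N T" if "lin_endo V T" "\<And>x. x \<in> N \<Longrightarrow> T x \<in> N" for T
    using that NV by (auto simp: lin_endo_def)
  then have "lin_endo ?N (Lm ?N)" "lin_endo ?N (L0 ?N)" "lin_endo ?N (Lp ?N)"
    using lin_Lm lin_L0 lin_Lp by auto
  moreover have "comm_eq ?N (L0 ?N) (Lm ?N) 1 (Lm ?N)" "comm_eq ?N (Lp ?N) (L0 ?N) 1 (Lp ?N)"
    "comm_eq ?N (Lp ?N) (Lm ?N) 2 (L0 ?N)"
    using is_sl2 NV by (auto simp: is_sl2mod_def comm_eq_def)
  ultimately show ?thesis by (simp add: is_sl2mod_def module_CC_of_kmod)
qed

lemma polyact_restrict [simp]: "polyact (V\<lparr>carrier := N\<rparr>) = polyact V"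
  by (simp add: polyact_def fun_eq_iff)

lemma submod_restrict: "sl2_submod V N \<Longrightarrow> sl2_submod (V\<lparr>carrier := N\<rparr>) U \<Longrightarrow> sl2_submod V U"
  by (auto simp: sl2_submod_def)

lemma casimir_restrict: "casimir V \<Longrightarrow> N \<subseteq> carrier V \<Longrightarrow> casimir (V\<lparr>carrier := N\<rparr>)"
  by (auto simp: casimir_def casimir_op_def)

end

text \<open>The vectors with a nonzero multiple in \<open>N\<close> form a rational submodule
  containing \<open>N\<close>, hence all of V.\<close>

lemma (in ratsl2) submod_dense:
  assumes RS: "R_simple V" and N: "sl2_submod V N" "N \<noteq> {\<zero>}" and x: "x \<in> carrier V"
  shows "\<exists>s. s \<noteq> 0 \<and> s \<cdot> x \<in> N"
proof -
  define U where "U = {x \<in> carrier V. \<exists>s. s \<noteq> 0 \<and> s \<cdot> x \<in> N}"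
  have semi: "T x \<in> U" if T: "semilin a T" and TN: "\<And>x. x \<in> N \<Longrightarrow> T x \<in> N" and x: "x \<in> U" for a T x
  proof -
    obtain s where s: "s \<noteq> 0" "s \<cdot> x \<in> N" "x \<in> carrier V" using x by (auto simp: U_def)
    then have "(s \<circ>\<^sub>p [:a, 1:]) \<cdot> T x \<in> N" using TN[OF s(2)] by (simp add: semilin_polyact[OF T])
    moreover have "s \<circ>\<^sub>p [:a, 1:] \<noteq> 0" using s(1) by simp
    ultimately show ?thesis using s(3) semilinD(1)[OF T] unfolding U_def by blast
  qed
  have poly: "p \<cdot> x \<in> U" if x: "x \<in> U" for p x
  proof -
    obtain s where s: "s \<noteq> 0" "s \<cdot> x \<in> N" "x \<in> carrier V" using x by (auto simp: U_def)
    have "p \<cdot> s \<cdot> x \<in> N" using s(2) by (rule submod_polyact[OF N(1)])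
    then have "s \<cdot> p \<cdot> x \<in> N" using P.act_commute[OF s(3), of s p] by simp
    then show ?thesis using s unfolding U_def by blast
  qed
  have "sl2_submod V U"
    unfolding sl2_submod_def
  proof (intro conjI ballI allI)
    show "\<zero> \<in> U" using submodD(2)[OF N(1)] by (auto simp: U_def intro!: exI[of _ 1])
    fix x assume x: "x \<in> U"
    show "c \<odot> x \<in> U" for c using poly[OF x, of "[:c:]"] x by (simp add: U_def)
    show "L0 V x \<in> U" using poly[OF x, of "[:0, 1:]"] x by (simp add: U_def)
    show "Lm V x \<in> U" using semi[OF semilin_Lm submodD(5)[OF N(1)] x] .
    show "Lp V x \<in> U" using semi[OF semilin_Lp submodD(7)[OF N(1)] x] .
    fix y assume y: "y \<in> U"
    obtain s where s: "s \<noteq> 0" "s \<cdot> x \<in> N" "x \<in> carrier V" using x by (auto simp: U_def)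
    obtain t where t: "t \<noteq> 0" "t \<cdot> y \<in> N" "y \<in> carrier V" using y by (auto simp: U_def)
    have "(t * s) \<cdot> (x \<oplus> y) = t \<cdot> s \<cdot> x \<oplus> s \<cdot> t \<cdot> y"
      using s t P.act_mult[of y s t] P.act_mult[of x t s] by (simp add: P.act_add_right mult.commute)
    also have "\<dots> \<in> N"
      using submod_polyact[OF N(1) s(2)] submod_polyact[OF N(1) t(2)] by (rule submodD(3)[OF N(1)])
    finally have "(t * s) \<cdot> (x \<oplus> y) \<in> N" .
    moreover have "t * s \<noteq> 0" using s t by simp
    ultimately show "x \<oplus> y \<in> U" using s t unfolding U_def by blast
  qed (auto simp: U_def)
  moreover have "y \<in> U" if y: "p \<noteq> 0" "y \<in> carrier V" "p \<cdot> y \<in> U" for p y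
  proof -
    obtain s where s: "s \<noteq> 0" "s \<cdot> p \<cdot> y \<in> N" using y(3) by (auto simp: U_def)
    then have "(s * p) \<cdot> y \<in> N" "s * p \<noteq> 0" using y by (auto simp: P.act_mult)
    then show ?thesis using y(2) unfolding U_def by blast
  qed
  ultimately have "R_sub V U" unfolding R_sub_iff by blast
  moreover have "N \<subseteq> U" using submodD(1)[OF N(1)] by (auto simp: U_def intro!: exI[of _ 1])
  then have "U \<noteq> {\<zero>}" using N submodD(2)[OF N(1)] by blast
  ultimately have "U = carrier V" using RS unfolding R_simple_def by blast
  then have "x \<in> U" using x by simp
  then show ?thesis by (simp add: U_def)
qed

theorem (in ratsl2) exists_simple_submod:
  assumes RS: "R_simple V"
  obtains W where "sl2_submod V W" "W \<noteq> {\<zero>}" "simple (V\<lparr>carrier := W\<rparr>)"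
proof -
  have br: bounded_rank using RS by (simp add: R_simple_def rational_iff)
  obtain v where v: "v \<in> carrier V" "v \<noteq> \<zero>"
    using RS C.zero_closed unfolding R_simple_def by blast
  have rel: "\<exists>R. coeff R 0 \<noteq> 0 \<and> pact T R v = \<zero>"
    if T: "semilin a T" and inj: "\<And>x. x \<in> carrier V \<Longrightarrow> T x = \<zero> \<Longrightarrow> x = \<zero>" for a T
  proof -
    obtain b n where b: "\<exists>j\<in>{..n}. b j \<noteq> 0" "pact T (\<Sum>j\<in>{..n}. monom (b j) j) v = \<zero>"
      using bounded_rank_relation[OF br T v(1)] by blast
    then have "(\<Sum>j\<in>{..n}. monom (b j) j) \<noteq> 0" using coeff_sum_monom[of "{..n}" _ b] by force
    then show ?thesis using relation_coeff_0[OF T inj v(1) _ b(2)] by blast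
  qed
  obtain R where R: "coeff R 0 \<noteq> 0" "pact (Lm V) R v = \<zero>"
    using rel[OF semilin_Lm Lm_injective[OF br]] by blast
  obtain S where S: "coeff S 0 \<noteq> 0" "pact (Lp V) S v = \<zero>"
    using rel[OF semilin_Lp Lp_injective[OF br]] by blast
  obtain g where g: "g \<noteq> 0" "\<And>N s. sl2_submod V N \<Longrightarrow> s \<noteq> 0 \<Longrightarrow> s \<cdot> v \<in> N \<Longrightarrow> g \<cdot> v \<in> N"
    using uniform_denominator[OF v(1) R S] by blast
  define W where "W = carrier V \<inter> \<Inter>{N. sl2_submod V N \<and> N \<noteq> {\<zero>}}"
  have W: "sl2_submod V W"
    unfolding sl2_submod_def W_def by (auto intro: submodD)
  \<comment> \<open>Density gives some s \<noteq> 0 with s v in \<open>N\<close>, and the uniform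
    denominator replaces s by g.\<close>
  have "g \<cdot> v \<in> N" if N: "sl2_submod V N" "N \<noteq> {\<zero>}" for N
    using submod_dense[OF RS N v(1)] g(2)[OF N(1)] by blast
  then have "g \<cdot> v \<in> W" using v by (auto simp: W_def)
  moreover have "g \<cdot> v \<noteq> \<zero>" using polyact_eq_0[OF v(1) g(1)] v(2) by blast
  ultimately have W0: "W \<noteq> {\<zero>}" by blast
  \<comment> \<open>A submodule of \<open>W\<close> is a submodule of V; if nonzero, it takes part
    in the intersection and so contains \<open>W\<close>.\<close>
  have "U = {\<zero>} \<or> U = W" if "sl2_submod (V\<lparr>carrier := W\<rparr>) U" for U
  proof -
    have "U \<subseteq> W" using that by (simp add: sl2_submod_def)
    then show ?thesis using submod_restrict[OF W that] unfolding W_def by blast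
  qed
  then have "simple (V\<lparr>carrier := W\<rparr>)"
    using is_sl2mod_submod[OF W] W0 by (simp add: simple_def)
  then show ?thesis using that W W0 by blast
qed

text \<open>The scalar comes from Dixmier's lemma on a simple submodule; it spreads to V by density,
  since the Casimir operator commutes with polynomials.\<close>

lemma (in ratsl2) R_simple_casimir:
  assumes RS: "R_simple V"
  shows "casimir V"
proof -
  obtain W where W: "sl2_submod V W" "W \<noteq> {\<zero>}" "simple (V\<lparr>carrier := W\<rparr>)"
    using exists_simple_submod[OF RS] .
  interpret W: sl2 "V\<lparr>carrier := W\<rparr>" using W(3) by unfold_locales (simp add: simple_def)
  obtain m where m: "\<And>x. x \<in> W \<Longrightarrow> cas x = m \<odot> x"
    using W.simple_casimir[OF W(3)] by (auto simp: casimir_def casimir_op_def)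
  have "cas x = m \<odot> x" if x: "x \<in> carrier V" for x
  proof -
    obtain s where s: "s \<noteq> 0" "s \<cdot> x \<in> W" using submod_dense[OF RS W(1,2) x] by blast
    have "s \<cdot> cas x = s \<cdot> (m \<odot> x)"
      using m[OF s(2)] x by (simp add: cas_polyact polyact_smult_commute)
    then show ?thesis using polyact_cancel[of "cas x" "m \<odot> x" s] s(1) x by simp
  qed
  then show ?thesis by (auto simp: casimir_def)
qed

text \<open>An R-simple module is Casimir by \<open>R_simple_casimir\<close>; conversely, every
  rational submodule of a Casimir module is Casimir with the same scalar.\<close>

lemma R_simple_iff_RC_simple: "R_simple V \<longleftrightarrow> RC_simple V"
proof
  assume RS: "R_simple V"
  then interpret ratsl2 V by (simp add: R_simple_def rational_iff)
  show "RC_simple V"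
    using RS R_simple_casimir[OF RS] by (auto simp: R_simple_def RC_simple_def RC_sub_def)
next
  assume RC: "RC_simple V"
  then interpret ratsl2 V by (simp add: RC_simple_def rational_iff)
  have "RC_sub V U" if "R_sub V U" for U
    using that RC casimir_restrict[of U] by (simp add: RC_sub_def R_sub_def RC_simple_def sl2_submod_def)
  then show "R_simple V" using RC by (simp add: R_simple_def RC_simple_def)
qed

text \<open>V is the simple submodule of M, taken on the same type; it is dense, so the universal
  property applies to the inclusion.\<close>

lemma R_simple_is_Frat:
  fixes M :: "'c sl2mod"
  assumes RS: "R_simple M"
  shows "\<exists>V :: 'c sl2mod. simple V \<and> torsion_free V \<and> sl2_iso (Frat V) M"
proof -
  interpret ratsl2 M using RS by (simp add: R_simple_def rational_iff)
  obtain W where W: "sl2_submod M W" "W \<noteq> {zero M}" "simple (M\<lparr>carrier := W\<rparr>)"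
    using exists_simple_submod[OF RS] .
  let ?W = "M\<lparr>carrier := W\<rparr>"
  have tfW: "torsion_free ?W"
    using tf submodD(1)[OF W(1)] by (auto simp: torsion_free_def)
  interpret W: tfsl2 ?W using W(3) tfW by unfold_locales (simp_all add: simple_def)
  have "sl2_iso (Frat ?W) M"
  proof (rule W.Frat_universal[where f = "\<lambda>x. x"])
    show "ratsl2 M" by (rule ratsl2_axioms)
    show "sl2_hom ?W M (\<lambda>x. x)" using submodD(1)[OF W(1)] by (auto simp: sl2_hom_def)
    show "\<exists>s x. s \<noteq> 0 \<and> x \<in> carrier ?W \<and> polyact M s y = x" if "y \<in> carrier M" for y
      using submod_dense[OF RS W(1,2) that] by auto
  qed simp
  then show ?thesis using W(3) tfW by blast
qed

lemma simple_tf_R_simple_Frat: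
  assumes S: "simple V" and tf: "torsion_free V"
  shows "R_simple (Frat V)"
proof -
  interpret tfsl2 V using S tf by unfold_locales (simp_all add: simple_def)
  obtain m where m: "\<And>x. x \<in> carrier V \<Longrightarrow> cas x = m \<odot>\<^bsub>V\<^esub> x"
    using simple_casimir[OF S] by (auto simp: casimir_def)
  obtain v where v: "v \<in> carrier V" "v \<noteq> zero V"
    using S C.zero_closed unfolding simple_def by blast
  interpret simple_tf V m v by unfold_locales (use S m v in auto)
  show ?thesis using R_simple_F[OF S bounded_rank_simple] .
qed

text \<open>Through \<open>h\<close>, V embeds densely into \<open>Frat W\<close>, which has the
  universal property of \<open>Frat V\<close>.\<close>

lemma Frat_iso_of_iso:
  assumes "simple V" "torsion_free V" "simple W" "torsion_free W" and iso: "sl2_iso V W"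
  shows "sl2_iso (Frat V) (Frat W)"
proof -
  interpret V: tfsl2 V using assms(1,2) by unfold_locales (simp_all add: simple_def)
  interpret W: tfsl2 W using assms(3,4) by unfold_locales (simp_all add: simple_def)
  obtain h where h: "sl2_hom V W h" "bij_betw h (carrier V) (carrier W)"
    using iso by (auto simp: sl2_iso_iff)
  show ?thesis
  proof (rule V.Frat_universal[where f = "\<lambda>x. W.fr (h x) 1"])
    show "ratsl2 (Frat W)" by (rule W.ratsl2_F)
    show "sl2_hom V (Frat W) (\<lambda>x. W.fr (h x) 1)" using h(1) W.sl2_hom_fr by (rule sl2_hom_comp)
    show "inj_on (\<lambda>x. W.fr (h x) 1) (carrier V)"
      using comp_inj_on[of h "carrier V" "\<lambda>x. W.fr x 1"] W.inj_fr h(2) by (simp add: bij_betw_def o_def)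
    show "\<exists>s x. s \<noteq> 0 \<and> x \<in> carrier V \<and> polyact (Frat W) s y = W.fr (h x) 1"
      if y: "y \<in> carrier (Frat W)" for y
    proof -
      obtain w p where w: "w \<in> carrier W" "p \<noteq> 0" "y = W.fr w p" using y by (rule W.fr_cases)
      have "w \<in> h ` carrier V" using w(1) h(2) by (simp add: bij_betw_def)
      then obtain x where "x \<in> carrier V" "w = h x" by blast
      then show ?thesis using w W.fr_clear by blast
    qed
  qed
qed

text \<open>V and W both embed into \<open>Frat W\<close>, and their images share a nonzero vector;
  by simplicity each image contains the other.\<close>

lemma iso_of_Frat_iso:
  assumes V: "simple V" "torsion_free V" and W: "simple W" "torsion_free W"
    and iso: "sl2_iso (Frat V) (Frat W)"
  shows "sl2_iso V W"
proof -
  interpret V: tfsl2 V using V by unfold_locales (simp_all add: simple_def)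
  interpret W: tfsl2 W using W by unfold_locales (simp_all add: simple_def)
  interpret FV: ratsl2 "Frat V" by (rule V.ratsl2_F)
  interpret FW: ratsl2 "Frat W" by (rule W.ratsl2_F)
  obtain g where g: "sl2_hom (Frat V) (Frat W) g" "bij_betw g (carrier (Frat V)) (carrier (Frat W))"
    using iso by (auto simp: sl2_iso_iff)
  define f where "f x = g (V.fr x 1)" for x
  have f: "sl2_hom V (Frat W) f"
    unfolding f_def using V.sl2_hom_fr g(1) by (rule sl2_hom_comp)
  have f_inj: "inj_on f (carrier V)"
  proof (rule inj_onI)
    fix x y assume *: "x \<in> carrier V" "y \<in> carrier V" "f x = f y"
    then have "V.fr x 1 = V.fr y 1"
      using g(2) by (auto simp: f_def bij_betw_def dest: inj_onD)
    then show "x = y" using * by (auto dest: inj_onD[OF V.inj_fr])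
  qed
  define k where "k w = W.fr w 1" for w
  have k: "sl2_hom W (Frat W) k" "inj_on k (carrier W)"
    unfolding k_def by (rule W.sl2_hom_fr, rule W.inj_fr)
  have sub: "sl2_submod V {x \<in> carrier V. f x \<in> k ` carrier W}"
      "sl2_submod W {w \<in> carrier W. k w \<in> f ` carrier V}"
    using submod_vimage[OF V.sl2_axioms FW.sl2_axioms f submod_image[OF W.sl2_axioms FW.sl2_axioms k(1)]]
      submod_vimage[OF W.sl2_axioms FW.sl2_axioms k(1) submod_image[OF V.sl2_axioms FW.sl2_axioms f]] .
  obtain x where x: "x \<in> carrier V" "x \<noteq> zero V"
    using V V.C.zero_closed unfolding simple_def by blast
  obtain w p where w: "w \<in> carrier W" "p \<noteq> 0" "f x = W.fr w p"
    using sl2_hom_closed[OF f x(1)] by (rule W.fr_cases)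
  \<comment> \<open>Multiplying by the denominator p of f x yields a vector common to both
    images.\<close>
  define y where "y = polyact V p x"
  have y: "y \<in> carrier V" "f y = k w"
    using x w sl2_hom_polyact[OF V.zmod_axioms FW.zmod_axioms f x(1), of p]
    by (simp_all add: y_def k_def W.fr_clear)
  have y0: "y \<noteq> zero V" using V.polyact_eq_0[OF x(1) w(2)] x(2) by (auto simp: y_def)
  have w0: "w \<noteq> zero W"
  proof
    assume "w = zero W"
    then have "f y = f (zero V)"
      using y(2) sl2_hom_zero[OF W.zmod_axioms FW.zmod_axioms k(1)]
        sl2_hom_zero[OF V.zmod_axioms FW.zmod_axioms f] by simp
    then show False using y0 y(1) inj_onD[OF f_inj, of y "zero V"] by simp
  qed
  have "y \<in> {x \<in> carrier V. f x \<in> k ` carrier W}" "w \<in> {w \<in> carrier W. k w \<in> f ` carrier V}"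
    using y w(1) by (auto intro: image_eqI[of _ f y])
  then have "{x \<in> carrier V. f x \<in> k ` carrier W} = carrier V" "{w \<in> carrier W. k w \<in> f ` carrier V} = carrier W"
    using sub V(1) W(1) y0 w0 unfolding simple_def by blast+
  then have "f ` carrier V = k ` carrier W" by blast
  then show ?thesis
    using V.sl2_axioms W.sl2_axioms FW.sl2_axioms f f_inj k by (intro sl2_isoI)
qed

text \<open>The bijection of isomorphism classes is expressed by an equivalence of isomorphisms
  (well defined and injective) and the existence of V for each M (surjective).\<close>

theorem theorem6p13:
  shows
  "(\<forall>V :: 'a sl2mod. simple V \<and> torsion_free V \<longrightarrow> finite_rank V)
   \<and> (\<forall>V :: 'a sl2mod. simple V \<and> torsion_free V \<longrightarrow> RC_simple (Frat V))
   \<and> (\<forall>(V :: 'a sl2mod) (W :: 'b sl2mod).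
        simple V \<and> torsion_free V \<and> simple W \<and> torsion_free W \<longrightarrow>
        (sl2_iso (Frat V) (Frat W) \<longleftrightarrow> sl2_iso V W))
   \<and> (\<forall>M :: 'c sl2mod. RC_simple M \<longrightarrow>
        (\<exists>V :: 'c sl2mod. simple V \<and> torsion_free V \<and> sl2_iso (Frat V) M))
   \<and> (\<forall>M :: 'c sl2mod. R_simple M \<longleftrightarrow> RC_simple M)"
proof (intro conjI allI impI)
  fix V :: "'a sl2mod" assume "simple V \<and> torsion_free V"
  then have RS: "R_simple (Frat V)" using simple_tf_R_simple_Frat by blast
  then show "finite_rank V" by (simp add: finite_rank_def R_simple_def rational_def)
  show "RC_simple (Frat V)" using RS by (simp add: R_simple_iff_RC_simple)
next
  fix V :: "'a sl2mod" and W :: "'b sl2mod"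
  assume "simple V \<and> torsion_free V \<and> simple W \<and> torsion_free W"
  then show "sl2_iso (Frat V) (Frat W) \<longleftrightarrow> sl2_iso V W"
    using Frat_iso_of_iso iso_of_Frat_iso by blast
next
  fix M :: "'c sl2mod"
  show "R_simple M \<longleftrightarrow> RC_simple M" by (rule R_simple_iff_RC_simple)
  assume "RC_simple M"
  then show "\<exists>V :: 'c sl2mod. simple V \<and> torsion_free V \<and> sl2_iso (Frat V) M"
    using R_simple_is_Frat by (simp add: R_simple_iff_RC_simple)
qed

end
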